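(* Let $\alpha,\beta,\gamma\in\mathcal K$ and let $(\overline{\mathcal{HV}},\varphi,\delta)$ be the Lie bialgebra with $\delta$ defined by $$\delta(L_n)=(n\alpha+\gamma)(I_0\otimes I_n-I_n\otimes I_0),\qquad \delta(I_n)=\beta(I_0\otimes I_n-I_n\otimes I_0),\qquad n\in\mathbb Z.$$ Then its dual Lie bialgebra is $(\overline{\mathcal{HV}}{}^{\circ},[\cdot,\cdot],\Delta)$, where $\overline{\mathcal{HV}}{}^\circ=\mathcal A^\circ\oplus\mathcal A^\circ$, the cobracket $\Delta$ is determined by $$\Delta\big((\varepsilon^p,0)\big)=\sum_{i+j=p+1}(j-i)(\varepsilon^i,0)\otimes(\varepsilon^j,0),\qquad \Delta\big((0,\varepsilon^p)\big)=\sum_{i+j=p+1}\big(j(\varepsilon^i,0)\otimes(0,\varepsilon^j)-i(0,\varepsilon^i)\otimes(\varepsilon^j,0)\big)\quad(p\in\mathbb Z),$$ and the bracket is uniquely determined by (for $i,j\in\mathbb Z$): (1) $[(\varepsilon^i,0),(\varepsilon^j,0)]=0$; (2) $[(\varepsilon^i,0),(0,\varepsilon^j)]=0$; (3) $[(0,\varepsilon^i),(0,\varepsilon^j)]=\begin{cases}(j\alpha+\gamma)(\varepsilon^{j+1},0)+\beta(0,\varepsilon^j)&\text{if } i=0,\ j\neq0,\\ 0&\text{if } i\neq0,\ j\neq0.\end{cases}$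
   Context: $\mathcal K$ is an algebraically closed field of characteristic zero, $\mathcal A=\mathcal K[x^{\pm1}]$, $\partial=\frac{d}{dx}$. $\overline{\mathcal{HV}}=\mathcal A\oplus\mathcal A$ is the centerless twisted Heisenberg-Virasoro algebra with Lie bracket $\varphi=[\cdot,\cdot]$, $[(f_1,f_2),(g_1,g_2)]=(f_1\partial g_1-g_1\partial f_1,\ f_1\partial g_2-g_1\partial f_2)$; with $L_m=(x^{m+1},0)$, $I_n=(0,x^n)$ this reads $[L_m,L_n]=(n-m)L_{m+n}$, $[I_m,I_n]=0$, $[L_m,I_n]=nI_{m+n}$. Lie bialgebra: a Lie algebra with a Lie cobracket $\delta$ such that $\delta[x,y]=x\cdot\delta(y)-y\cdot\delta(x)$, where $x\cdot(y\otimes z)=[x,y]\otimes z+y\otimes[x,z]$. $\varphi^*:\overline{\mathcal{HV}}{}^*\to(\overline{\mathcal{HV}}\otimes\overline{\mathcal{HV}})^*$ is the dual of the bracket; $\overline{\mathcal{HV}}{}^{\circ}$ is the maximal good subspace of $\overline{\mathcal{HV}}{}^*$, i.e. the sum of all subspaces $U$ with $\varphi^*(U)\subset U\otimes U$. It equals $\mathcal A^\circ\oplus\mathcal A^\circ$ with $\mathcal A^\circ=\{\sum_{i\in\mathbb Z}f_i\varepsilon^i\in\mathcal A^*\mid \exists\, r\in\mathbb N,\ c_1,\dots,c_r\in\mathcal K:\ f_n=\sum_{j=1}^r c_jf_{n-j}\ \forall n\in\mathbb Z\}$. The dual Lie bialgebra of a Lie bialgebra $(\overline{\mathcal{HV}},\varphi,\delta)$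 is $\overline{\mathcal{HV}}{}^\circ$ with bracket and cobracket dual to $\delta$ and $\varphi$: $\langle[f,h],\xi\rangle=\langle f\otimes h,\delta(\xi)\rangle$ and $\langle\Delta f,\xi\otimes\eta\rangle=\langle f,[\xi,\eta]\rangle$ for $f,h\in\overline{\mathcal{HV}}{}^\circ$, $\xi,\eta\in\overline{\mathcal{HV}}$. $\varepsilon^i\in\mathcal A^*$ is given by $\varepsilon^i(x^j)=\delta_{i,j}$; every $f\in\mathcal A^*$ is written as a formal (possibly infinite) sum $\sum_j f_j\varepsilon^j$, $f_j=f(x^j)$. $(\varepsilon^i,0)(x^k,x^l)=\delta_{i,k}$, $(0,\varepsilon^i)(x^k,x^l)=\delta_{i,l}$. Infinite sums denote functionals evaluated termwise; the formulas on the $\varepsilon^i$ are formulas for the dual maps $\varphi^*$ and $(f,h)\mapsto(f\otimes h)\circ\delta$ on these functionals, and the structure on $\overline{\mathcal{HV}}{}^\circ$ is obtained by extending them to formal infinite linear combinations (remaining brackets following from skew-symmetry). *)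

theory Defs
  imports
    "HOL-Computational_Algebra.Polynomial"
    "HOL-Library.Poly_Mapping"
    "HOL-Library.Function_Algebras"
    "HOL-Library.Product_Plus"
begin

section \<open>Vector spaces of functions and multilinear forms\<close>

definition fscale :: "'k::field \<Rightarrow> ('x \<Rightarrow> 'k) \<Rightarrow> ('x \<Rightarrow> 'k)" where
  "fscale c f = (\<lambda>x. c * f x)"

interpretation fun_vs: vector_space fscale
  by unfold_locales (auto simp: fscale_def algebra_simps fun_eq_iff)

definition linear_on ::
  "('k::field \<Rightarrow> 'v::ab_group_add \<Rightarrow> 'v) \<Rightarrow> ('k \<Rightarrow> 'w::ab_group_add \<Rightarrow> 'w) \<Rightarrow> 'v set \<Rightarrow> ('v \<Rightarrow> 'w) \<Rightarrow> bool"
  where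
  "linear_on s s' U f \<longleftrightarrow>
     (\<forall>x\<in>U. \<forall>y\<in>U. f (x + y) = f x + f y) \<and> (\<forall>c. \<forall>x\<in>U. f (s c x) = s' c (f x))"

definition bilinear_form_on ::
  "('k::field \<Rightarrow> 'v::ab_group_add \<Rightarrow> 'v) \<Rightarrow> 'v set \<Rightarrow> ('v \<times> 'v \<Rightarrow> 'k) \<Rightarrow> bool" where
  "bilinear_form_on s U B \<longleftrightarrow>
     (\<forall>x\<in>U. linear_on s (*) U (\<lambda>y. B (x, y))) \<and> (\<forall>y\<in>U. linear_on s (*) U (\<lambda>x. B (x, y)))"

definition trilinear_form_on ::
  "('k::field \<Rightarrow> 'v::ab_group_add \<Rightarrow> 'v) \<Rightarrow> 'v set \<Rightarrow> ('v \<times> 'v \<times> 'v \<Rightarrow> 'k) \<Rightarrow> bool" where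
  "trilinear_form_on s U T \<longleftrightarrow>
     (\<forall>y\<in>U. \<forall>z\<in>U. linear_on s (*) U (\<lambda>x. T (x, y, z))) \<and>
     (\<forall>x\<in>U. \<forall>z\<in>U. linear_on s (*) U (\<lambda>y. T (x, y, z))) \<and>
     (\<forall>x\<in>U. \<forall>y\<in>U. linear_on s (*) U (\<lambda>z. T (x, y, z)))"

section \<open>Tensor products\<close>

text \<open>
  Over a field, \<open>U \<otimes> U\<close> embeds canonically into the dual of the space of bilinear forms on \<open>U\<close>
  by letting \<open>x \<otimes> y\<close> be evaluation at \<open>(x, y)\<close>; we take its image, the span of these evaluations,
  as the tensor product. The default value 0 at functions that are not bilinear on \<open>U\<close> makes
  equality of tensors coincide with equality of functions. The pairing of a bilinear form \<open>B\<close>,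
  regarded as an element of the dual of \<open>U \<otimes> U\<close>, with a tensor \<open>t\<close> is \<open>t B\<close>.
  Threefold tensors are treated in the same way, with trilinear forms.
\<close>

type_synonym ('k, 'v) tensor2 = "('v \<times> 'v \<Rightarrow> 'k) \<Rightarrow> 'k"
type_synonym ('k, 'v) tensor3 = "('v \<times> 'v \<times> 'v \<Rightarrow> 'k) \<Rightarrow> 'k"

definition tensor ::
  "('k::field \<Rightarrow> 'v::ab_group_add \<Rightarrow> 'v) \<Rightarrow> 'v set \<Rightarrow> 'v \<Rightarrow> 'v \<Rightarrow> ('k, 'v) tensor2" where
  "tensor s U x y = (\<lambda>B. if bilinear_form_on s U B then B (x, y) else 0)"

definition tensor_space ::
  "('k::field \<Rightarrow> 'v::ab_group_add \<Rightarrow> 'v) \<Rightarrow> 'v set \<Rightarrow> ('k, 'v) tensor2 set" where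
  "tensor_space s U = fun_vs.span {tensor s U x y | x y. x \<in> U \<and> y \<in> U}"

lemma tensor_bilinear:
  "tensor s UNIV x (y + z) = tensor s UNIV x y + tensor s UNIV x z"
  "tensor s UNIV (x + y) z = tensor s UNIV x z + tensor s UNIV y z"
  "tensor s UNIV x (s c y) = fscale c (tensor s UNIV x y)"
  "tensor s UNIV (s c x) y = fscale c (tensor s UNIV x y)"
  by (auto simp: fun_eq_iff tensor_def fscale_def bilinear_form_on_def linear_on_def)

text \<open>\<open>x \<otimes> y \<mapsto> S x \<otimes> T y\<close> for \<open>S\<close> and \<open>T\<close> linear on \<open>U\<close>.\<close>

definition tensor_map ::
  "('k::field \<Rightarrow> 'v::ab_group_add \<Rightarrow> 'v) \<Rightarrow> 'v set \<Rightarrow> ('v \<Rightarrow> 'v) \<Rightarrow> ('v \<Rightarrow> 'v) \<Rightarrow>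
     ('k, 'v) tensor2 \<Rightarrow> ('k, 'v) tensor2" where
  "tensor_map s U S T t =
     (\<lambda>B. if bilinear_form_on s U B then t (\<lambda>(x, y). B (S x, T y)) else 0)"

text \<open>\<open>x \<otimes> y \<mapsto> y \<otimes> x\<close>.\<close>

definition tensor_flip :: "('k, 'v) tensor2 \<Rightarrow> ('k, 'v) tensor2" where
  "tensor_flip t = (\<lambda>B. t (\<lambda>(x, y). B (y, x)))"

text \<open>\<open>x \<otimes> y \<mapsto> x \<otimes> \<delta> y\<close>.\<close>

definition id_tensor_cobracket ::
  "('k::field \<Rightarrow> 'v::ab_group_add \<Rightarrow> 'v) \<Rightarrow> 'v set \<Rightarrow> ('v \<Rightarrow> ('k, 'v) tensor2) \<Rightarrow>
     ('k, 'v) tensor2 \<Rightarrow> ('k, 'v) tensor3" where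
  "id_tensor_cobracket s U \<delta> t =
     (\<lambda>T. if trilinear_form_on s U T then t (\<lambda>(x, y). \<delta> y (\<lambda>(u, v). T (x, u, v))) else 0)"

text \<open>\<open>x \<otimes> y \<otimes> z \<mapsto> y \<otimes> z \<otimes> x\<close>.\<close>

definition tensor_cycle :: "('k, 'v) tensor3 \<Rightarrow> ('k, 'v) tensor3" where
  "tensor_cycle t = (\<lambda>T. t (\<lambda>(x, y, z). T (y, z, x)))"

section \<open>Lie bialgebras\<close>

definition lie_algebra_on ::
  "('k::field \<Rightarrow> 'v::ab_group_add \<Rightarrow> 'v) \<Rightarrow> 'v set \<Rightarrow> ('v \<Rightarrow> 'v \<Rightarrow> 'v) \<Rightarrow> bool" where
  "lie_algebra_on s U br \<longleftrightarrow>
     vector_space s \<and> module.subspace s U \<and>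
     (\<forall>x\<in>U. \<forall>y\<in>U. br x y \<in> U) \<and>
     (\<forall>x\<in>U. linear_on s s U (br x)) \<and>
     (\<forall>y\<in>U. linear_on s s U (\<lambda>x. br x y)) \<and>
     (\<forall>x\<in>U. br x x = 0) \<and>
     (\<forall>x\<in>U. \<forall>y\<in>U. \<forall>z\<in>U. br x (br y z) + br y (br z x) + br z (br x y) = 0)"

definition lie_coalgebra_on ::
  "('k::field \<Rightarrow> 'v::ab_group_add \<Rightarrow> 'v) \<Rightarrow> 'v set \<Rightarrow> ('v \<Rightarrow> ('k, 'v) tensor2) \<Rightarrow> bool" where
  "lie_coalgebra_on s U \<delta> \<longleftrightarrow>
     vector_space s \<and> module.subspace s U \<and>
     (\<forall>x\<in>U. \<delta> x \<in> tensor_space s U) \<and>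
     linear_on s fscale U \<delta> \<and>
     (\<forall>x\<in>U. tensor_flip (\<delta> x) = - \<delta> x) \<and>
     (\<forall>x\<in>U. let t = id_tensor_cobracket s U \<delta> (\<delta> x)
       in t + tensor_cycle t + tensor_cycle (tensor_cycle t) = 0)"

definition tensor_action ::
  "('k::field \<Rightarrow> 'v::ab_group_add \<Rightarrow> 'v) \<Rightarrow> 'v set \<Rightarrow> ('v \<Rightarrow> 'v \<Rightarrow> 'v) \<Rightarrow>
     'v \<Rightarrow> ('k, 'v) tensor2 \<Rightarrow> ('k, 'v) tensor2" where
  "tensor_action s U br x t = tensor_map s U (br x) id t + tensor_map s U id (br x) t"

definition lie_bialgebra_on ::
  "('k::field \<Rightarrow> 'v::ab_group_add \<Rightarrow> 'v) \<Rightarrow> 'v set \<Rightarrow> ('v \<Rightarrow> 'v \<Rightarrow> 'v) \<Rightarrow>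
     ('v \<Rightarrow> ('k, 'v) tensor2) \<Rightarrow> bool" where
  "lie_bialgebra_on s U br \<delta> \<longleftrightarrow>
     lie_algebra_on s U br \<and> lie_coalgebra_on s U \<delta> \<and>
     (\<forall>x\<in>U. \<forall>y\<in>U. \<delta> (br x y) = tensor_action s U br x (\<delta> y) - tensor_action s U br y (\<delta> x))"

section \<open>The dual Lie bialgebra\<close>

text \<open>
  The Lie algebra \<open>V\<close> that is dualized is a whole type with scalar multiplication \<open>s\<close>, and its dual
  is a subspace of the function space. The dual of \<open>V \<otimes> V\<close> is identified with the bilinear forms
  on \<open>V\<close>, a tensor of functionals being the product form.
\<close>

definition dual_space :: "('k::field \<Rightarrow> 'v::ab_group_add \<Rightarrow> 'v) \<Rightarrow> ('v \<Rightarrow> 'k) set" where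
  "dual_space s = {f. Vector_Spaces.linear s (*) f}"

definition form_tensor :: "('v \<Rightarrow> 'k::field) \<Rightarrow> ('v \<Rightarrow> 'k) \<Rightarrow> 'v \<times> 'v \<Rightarrow> 'k" where
  "form_tensor f h = (\<lambda>(x, y). f x * h y)"

text \<open>
  The embedding of \<open>V\<^sup>* \<otimes> V\<^sup>*\<close> into the dual of \<open>V \<otimes> V\<close>, so that
  \<open>tensor_form t (\<xi>, \<eta>)\<close> is the pairing of \<open>t\<close> with \<open>\<xi> \<otimes> \<eta>\<close>.
\<close>

definition tensor_form :: "('k::field, 'v \<Rightarrow> 'k) tensor2 \<Rightarrow> 'v \<times> 'v \<Rightarrow> 'k" where
  "tensor_form t = (\<lambda>(\<xi>, \<eta>). t (\<lambda>(g, h). g \<xi> * h \<eta>))"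

text \<open>The map \<open>\<phi>\<^sup>*\<close> dual to the bracket.\<close>

definition bracket_dual :: "('v \<Rightarrow> 'v \<Rightarrow> 'v) \<Rightarrow> ('v \<Rightarrow> 'k) \<Rightarrow> 'v \<times> 'v \<Rightarrow> 'k" where
  "bracket_dual br f = (\<lambda>(\<xi>, \<eta>). f (br \<xi> \<eta>))"

definition good_subspace ::
  "('k::field \<Rightarrow> 'v::ab_group_add \<Rightarrow> 'v) \<Rightarrow> ('v \<Rightarrow> 'v \<Rightarrow> 'v) \<Rightarrow> ('v \<Rightarrow> 'k) set \<Rightarrow> bool" where
  "good_subspace s br U \<longleftrightarrow>
     U \<subseteq> dual_space s \<and> fun_vs.subspace U \<and>
     bracket_dual br ` U \<subseteq> tensor_form ` tensor_space fscale U"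

definition maximal_good_subspace ::
  "('k::field \<Rightarrow> 'v::ab_group_add \<Rightarrow> 'v) \<Rightarrow> ('v \<Rightarrow> 'v \<Rightarrow> 'v) \<Rightarrow> ('v \<Rightarrow> 'k) set" where
  "maximal_good_subspace s br = fun_vs.span (\<Union> {U. good_subspace s br U})"

text \<open>The bracket \<open>(f, h) \<mapsto> (f \<otimes> h) \<circ> \<delta>\<close>, defined on the full dual.\<close>

definition dual_bracket ::
  "('v \<Rightarrow> ('k::field, 'v) tensor2) \<Rightarrow> ('v \<Rightarrow> 'k) \<Rightarrow> ('v \<Rightarrow> 'k) \<Rightarrow> ('v \<Rightarrow> 'k)" where
  "dual_bracket \<delta> f h = (\<lambda>\<xi>. \<delta> \<xi> (form_tensor f h))"

definition dual_cobracket ::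
  "('k::field \<Rightarrow> 'v::ab_group_add \<Rightarrow> 'v) \<Rightarrow> ('v \<Rightarrow> 'v \<Rightarrow> 'v) \<Rightarrow>
     ('v \<Rightarrow> 'k) \<Rightarrow> ('k, 'v \<Rightarrow> 'k) tensor2" where
  "dual_cobracket s br f =
     (THE t. t \<in> tensor_space fscale (maximal_good_subspace s br) \<and>
             tensor_form t = bracket_dual br f)"

definition is_dual_lie_bialgebra ::
  "('k::field \<Rightarrow> 'v::ab_group_add \<Rightarrow> 'v) \<Rightarrow> ('v \<Rightarrow> 'v \<Rightarrow> 'v) \<Rightarrow> ('v \<Rightarrow> ('k, 'v) tensor2) \<Rightarrow>
     ('v \<Rightarrow> 'k) set \<Rightarrow> (('v \<Rightarrow> 'k) \<Rightarrow> ('v \<Rightarrow> 'k) \<Rightarrow> ('v \<Rightarrow> 'k)) \<Rightarrow>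
     (('v \<Rightarrow> 'k) \<Rightarrow> ('k, 'v \<Rightarrow> 'k) tensor2) \<Rightarrow> bool" where
  "is_dual_lie_bialgebra s br \<delta> U b \<Delta> \<longleftrightarrow>
     U = maximal_good_subspace s br \<and>
     lie_bialgebra_on fscale U b \<Delta> \<and>
     (\<forall>f\<in>U. \<forall>h\<in>U. \<forall>\<xi>. b f h \<xi> = \<delta> \<xi> (form_tensor f h)) \<and>
     (\<forall>f\<in>U. \<forall>\<xi> \<eta>. tensor_form (\<Delta> f) (\<xi>, \<eta>) = f (br \<xi> \<eta>))"

section \<open>The centerless twisted Heisenberg-Virasoro algebra\<close>

text \<open>
  With convolution as multiplication, \<open>int \<Rightarrow>\<^sub>0 'k\<close> is the ring of Laurent polynomials,
  and \<open>x\<^sup>n\<close> is \<open>Poly_Mapping.single n 1\<close>.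
\<close>

type_synonym 'k laurent = "int \<Rightarrow>\<^sub>0 'k"
type_synonym 'k hv = "'k laurent \<times> 'k laurent"

abbreviation lmonom :: "int \<Rightarrow> 'k::field laurent" where
  "lmonom n \<equiv> Poly_Mapping.single n 1"

definition laurent_scale :: "'k::field \<Rightarrow> 'k laurent \<Rightarrow> 'k laurent" where
  "laurent_scale c f = Poly_Mapping.map ((*) c) f"

lift_definition laurent_deriv :: "'k::field laurent \<Rightarrow> 'k laurent" is
  "\<lambda>f n. of_int (n + 1) * f (n + 1)"
proof -
  fix f :: "int \<Rightarrow> 'k" assume "finite {n. f n \<noteq> 0}"
  then have "finite ((\<lambda>n. n - 1) ` {n. f n \<noteq> 0})" by simp
  then show "finite {n. of_int (n + 1) * f (n + 1) \<noteq> 0}"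
    by (rule finite_subset[rotated]) (force simp: image_iff intro: exI[of _ "_ + 1"])
qed

definition hv_scale :: "'k::field \<Rightarrow> 'k hv \<Rightarrow> 'k hv" where
  "hv_scale c \<xi> = (laurent_scale c (fst \<xi>), laurent_scale c (snd \<xi>))"

lemma lookup_laurent_scale:
  "Poly_Mapping.lookup (laurent_scale c f) n = c * Poly_Mapping.lookup f n"
  by (simp add: laurent_scale_def map.rep_eq when_def)

lemma vector_space_laurent_scale: "vector_space laurent_scale"
  by unfold_locales
    (auto intro!: poly_mapping_eqI simp: lookup_laurent_scale lookup_add algebra_simps)

lemma vector_space_hv_scale: "vector_space hv_scale"
proof -
  interpret vector_space laurent_scale by (rule vector_space_laurent_scale)
  show ?thesis
    by unfold_locales (auto simp: hv_scale_def scale_right_distrib scale_left_distrib prod_eq_iff)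
qed

fun hv_bracket :: "'k::field hv \<Rightarrow> 'k hv \<Rightarrow> 'k hv" where
  "hv_bracket (f1, f2) (g1, g2) =
     (f1 * laurent_deriv g1 - g1 * laurent_deriv f1, f1 * laurent_deriv g2 - g1 * laurent_deriv f2)"

definition hv_L :: "int \<Rightarrow> 'k::field hv" where
  "hv_L n = (lmonom (n + 1), 0)"

definition hv_I :: "int \<Rightarrow> 'k::field hv" where
  "hv_I n = (0, lmonom n)"

lemma laurent_scale_single: "laurent_scale c (Poly_Mapping.single n d) = Poly_Mapping.single n (c * d)"
  by (auto intro!: poly_mapping_eqI simp: lookup_laurent_scale lookup_single when_def)

lemma laurent_scale_0: "laurent_scale c 0 = 0"
  by (auto intro!: poly_mapping_eqI simp: lookup_laurent_scale)

lemma laurent_deriv_single: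
  "laurent_deriv (Poly_Mapping.single n c) = Poly_Mapping.single (n - 1) (of_int n * c)"
  by (auto intro!: poly_mapping_eqI simp: laurent_deriv.rep_eq lookup_single when_def)

lemma laurent_deriv_0: "laurent_deriv 0 = 0"
  by (auto intro!: poly_mapping_eqI simp: laurent_deriv.rep_eq)

lemma hv_bracket_L_L: "hv_bracket (hv_L m) (hv_L n) = hv_scale (of_int (n - m)) (hv_L (m + n))"
  by (simp add: hv_L_def hv_scale_def laurent_deriv_single laurent_deriv_0 laurent_scale_0
      laurent_scale_single mult_single add_ac flip: single_diff)

lemma hv_bracket_I_I: "hv_bracket (hv_I m) (hv_I n) = 0"
  by (simp add: hv_I_def zero_prod_def)

lemma hv_bracket_L_I: "hv_bracket (hv_L m) (hv_I n) = hv_scale (of_int n) (hv_I (m + n))"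
  by (simp add: hv_L_def hv_I_def hv_scale_def laurent_deriv_single laurent_deriv_0 laurent_scale_0
      laurent_scale_single mult_single add_ac)

abbreviation hv_tensor :: "'k::field hv \<Rightarrow> 'k hv \<Rightarrow> ('k, 'k hv) tensor2" where
  "hv_tensor \<equiv> tensor hv_scale UNIV"

lemma hv_cobracket_exists:
  fixes \<alpha> \<beta> \<gamma> :: "'k::field"
  obtains \<delta> :: "'k hv \<Rightarrow> ('k, 'k hv) tensor2" where
    "Vector_Spaces.linear hv_scale fscale \<delta>"
    "\<And>n. \<delta> (hv_L n) =
       fscale (of_int n * \<alpha> + \<gamma>) (hv_tensor (hv_I 0) (hv_I n) - hv_tensor (hv_I n) (hv_I 0))"
    "\<And>n. \<delta> (hv_I n) =
       fscale \<beta> (hv_tensor (hv_I 0) (hv_I n) - hv_tensor (hv_I n) (hv_I 0))"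
proof -
  interpret L: vector_space "laurent_scale :: 'k \<Rightarrow> _" by (rule vector_space_laurent_scale)
  interpret H: vector_space "hv_scale :: 'k \<Rightarrow> _" by (rule vector_space_hv_scale)
  define E :: "'k laurent \<Rightarrow> 'k laurent"
    where "E f = laurent_scale \<alpha> (laurent_deriv f) + laurent_scale (\<gamma> - \<alpha>) (Poly_Mapping.map_key (\<lambda>n. n + 1) f)" for f
  have lookup_shift: "Poly_Mapping.lookup (Poly_Mapping.map_key (\<lambda>n. n + 1) f) n = Poly_Mapping.lookup f (n + 1)"
    for f :: "'k laurent" and n :: int
    by (subst map_key.rep_eq) (auto simp: inj_def)
  define D :: "'k hv \<Rightarrow> 'k hv" where "D \<xi> = (0, E (fst \<xi>) + laurent_scale \<beta> (snd \<xi>))" for \<xi>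
  have E_add: "E (f + g) = E f + E g" for f g
    by (auto intro!: poly_mapping_eqI simp: E_def laurent_deriv.rep_eq lookup_add lookup_laurent_scale lookup_shift algebra_simps)
  have E_scale: "E (laurent_scale c f) = laurent_scale c (E f)" for c f
    by (auto intro!: poly_mapping_eqI simp: E_def laurent_deriv.rep_eq lookup_add lookup_laurent_scale lookup_shift algebra_simps)
  have D_add: "D (x + y) = D x + D y" for x y
    by (simp add: D_def E_add L.scale_right_distrib algebra_simps)
  have D_scale: "D (hv_scale c x) = hv_scale c (D x)" for c x
    by (simp add: D_def hv_scale_def E_scale L.scale_right_distrib mult.commute)
  have E_lmonom: "E (lmonom n) = Poly_Mapping.single (n - 1) (of_int n * \<alpha> + (\<gamma> - \<alpha>))" for n
    by (auto intro!: poly_mapping_eqI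
        simp: E_def laurent_deriv_single lookup_shift lookup_add lookup_laurent_scale lookup_single
          when_def)
  have D_L: "D (hv_L n) = hv_scale (of_int n * \<alpha> + \<gamma>) (hv_I n)" for n
    by (simp add: D_def hv_L_def hv_I_def hv_scale_def E_lmonom laurent_scale_single
        laurent_scale_0 algebra_simps del: L.scale_left_distrib)
  have D_I: "D (hv_I n) = hv_scale \<beta> (hv_I n)" for n
    by (auto intro!: poly_mapping_eqI simp: D_def hv_I_def hv_scale_def E_def laurent_deriv.rep_eq
        lookup_shift lookup_add lookup_laurent_scale)
  define \<delta> :: "'k hv \<Rightarrow> ('k, 'k hv) tensor2"
    where "\<delta> \<xi> = hv_tensor (hv_I 0) (D \<xi>) - hv_tensor (D \<xi>) (hv_I 0)" for \<xi>
  show thesis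
  proof
    show "Vector_Spaces.linear hv_scale fscale \<delta>"
      by unfold_locales
        (simp_all add: \<delta>_def D_add D_scale tensor_bilinear fun_vs.scale_right_diff_distrib)
  qed (simp_all add: \<delta>_def D_L D_I tensor_bilinear fun_vs.scale_right_diff_distrib)
qed

abbreviation hv_dual :: "('k::field hv \<Rightarrow> 'k) set" where
  "hv_dual \<equiv> dual_space hv_scale"

abbreviation hv_circ :: "('k::field hv \<Rightarrow> 'k) set" where
  "hv_circ \<equiv> maximal_good_subspace hv_scale hv_bracket"

definition laurent_circ :: "('k::field laurent \<Rightarrow> 'k) set" where
  "laurent_circ = {f \<in> dual_space laurent_scale.
     \<exists>(r::nat) c. \<forall>n. f (lmonom n) = (\<Sum>j = 1..r. c j * f (lmonom (n - int j)))}"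

text \<open>The element \<open>(f, g)\<close> of the direct sum of two copies of the dual of the Laurent polynomials.\<close>

definition functional_pair ::
  "('k::field laurent \<Rightarrow> 'k) \<Rightarrow> ('k laurent \<Rightarrow> 'k) \<Rightarrow> 'k hv \<Rightarrow> 'k" where
  "functional_pair f g = (\<lambda>\<xi>. f (fst \<xi>) + g (snd \<xi>))"

definition eps :: "int \<Rightarrow> 'k::field laurent \<Rightarrow> 'k" where
  "eps i = (\<lambda>f. Poly_Mapping.lookup f i)"

abbreviation eps1 :: "int \<Rightarrow> 'k::field hv \<Rightarrow> 'k" where
  "eps1 i \<equiv> functional_pair (eps i) 0"

abbreviation eps2 :: "int \<Rightarrow> 'k::field hv \<Rightarrow> 'k" where
  "eps2 i \<equiv> functional_pair 0 (eps i)"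

section \<open>Formal infinite linear combinations\<close>

text \<open>\<open>g\<close> is the sum of the functionals \<open>F i\<close>, \<open>i \<in> I\<close>, every evaluation being a finite sum.\<close>

definition is_formal_sum :: "('i \<Rightarrow> 'x \<Rightarrow> 'k::field) \<Rightarrow> 'i set \<Rightarrow> ('x \<Rightarrow> 'k) \<Rightarrow> bool" where
  "is_formal_sum F I g \<longleftrightarrow>
     (\<forall>x. finite {i\<in>I. F i x \<noteq> 0} \<and> g x = (\<Sum>i\<in>{i\<in>I. F i x \<noteq> 0}. F i x))"

text \<open>
  The index type \<open>int + int\<close> runs through the monomials \<open>(x\<^sup>i, 0)\<close> and \<open>(0, x\<^sup>i)\<close> and through the
  functionals dual to them. A functional \<open>f\<close> has the formal expansion
  \<open>\<Sum>a. f (hv_monom a) hv_eps a\<close>, and the following two predicates say that a map on functionals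
  extends its values on the \<open>hv_eps a\<close> to formal infinite linear combinations. The \<open>hv_eps a\<close>
  are not in \<open>hv_circ\<close> themselves, so these are predicates of maps on the full dual.
\<close>

definition hv_monom :: "int + int \<Rightarrow> 'k::field hv" where
  "hv_monom a = (case a of Inl i \<Rightarrow> (lmonom i, 0) | Inr i \<Rightarrow> (0, lmonom i))"

definition hv_eps :: "int + int \<Rightarrow> 'k::field hv \<Rightarrow> 'k" where
  "hv_eps a = (case a of Inl i \<Rightarrow> eps1 i | Inr i \<Rightarrow> eps2 i)"

definition formally_linear :: "(('k::field hv \<Rightarrow> 'k) \<Rightarrow> ('x \<Rightarrow> 'k)) \<Rightarrow> bool" where
  "formally_linear \<Psi> \<longleftrightarrow>
     (\<forall>f\<in>hv_dual. is_formal_sum (\<lambda>a. fscale (f (hv_monom a)) (\<Psi> (hv_eps a))) UNIV (\<Psi> f))"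

definition formally_bilinear ::
  "(('k::field hv \<Rightarrow> 'k) \<Rightarrow> ('k hv \<Rightarrow> 'k) \<Rightarrow> ('x \<Rightarrow> 'k)) \<Rightarrow> bool" where
  "formally_bilinear b \<longleftrightarrow>
     (\<forall>f\<in>hv_dual. \<forall>h\<in>hv_dual.
        is_formal_sum (\<lambda>(a, a'). fscale (f (hv_monom a) * h (hv_monom a')) (b (hv_eps a) (hv_eps a')))
          UNIV (b f h))"

end

theory Submission
  imports Defs
begin

text \<open>
  The proof separates a general part on Lie algebras and Lie bialgebras \<open>V\<close> from computations in the
  Heisenberg-Virasoro algebra.

  In general, the maximal good subspace of \<open>V\<^sup>*\<close> consists of all functionals \<open>f\<close> for which the form
  \<open>(\<xi>, \<eta>) \<mapsto> f [\<xi>, \<eta>]\<close> has finite rank (\<open>maximal_good_subspace_eq\<close>): a form of finite rank can be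
  factored through its own rows and columns (\<open>rank_reduction\<close>), these are coadjoint translates of \<open>f\<close>, and
  by the Jacobi identity the translates again satisfy the finite rank condition. A tensor of
  functionals is determined by its values (\<open>tensor_form_inject\<close>, \<open>trilinear_sum_eq_0\<close>), so all axioms of
  the dual Lie bialgebra can be checked after pairing with elements of \<open>V\<close>, where they turn into the
  axioms of \<open>V\<close> (\<open>is_dual_lie_bialgebra_finite_dual\<close>). Closure under the dual bracket
  follows from the cocycle condition.

  For the Heisenberg-Virasoro algebra, \<open>I\<^sub>0\<close> is central and the cobracket is
  \<open>\<xi> \<mapsto> I\<^sub>0 \<otimes> D \<xi> - D \<xi> \<otimes> I\<^sub>0\<close> with a derivation \<open>D\<close> that has values in the abelian ideal spanned by the \<open>I\<^sub>n\<close>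
  and satisfies \<open>D I\<^sub>0 = \<beta> I\<^sub>0\<close>; this gives the Lie bialgebra axioms and the
  explicit bracket of functionals. Finite rank of \<open>(\<xi>, \<eta>) \<mapsto> f [\<xi>, \<eta>]\<close> is
  equivalent to finite rank of the Hankel matrices of the two components of \<open>f\<close>, which in turn is
  equivalent to linear recursiveness (\<open>hv_circ_eq\<close>). The formulas on the
  coordinate functionals are the coordinates of the bracket and of \<open>D\<close>, and a formally linear map is
  determined by its values on the coordinate functionals.
\<close>

section \<open>Tensors as finite sums\<close>

lemma sum_fun_apply: "(\<Sum>i\<in>K. f i) x = (\<Sum>i\<in>K. f i x)"
  by (induction K rule: infinite_finite_induct) auto

lemma linear_on_0:
  assumes "vector_space s" "vector_space s'" "module.subspace s U" "linear_on s s' U f"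
  shows "f 0 = 0"
proof -
  interpret V: vector_space s by fact
  interpret W: vector_space s' by fact
  from assms(4) V.subspace_0[OF assms(3)] have "f (s 0 0) = s' 0 (f 0)"
    unfolding linear_on_def by blast
  then show ?thesis by simp
qed

lemma linear_on_sum:
  assumes vs: "vector_space s" "vector_space s'" and U: "module.subspace s U" and f: "linear_on s s' U f"
    and "\<And>i. i \<in> K \<Longrightarrow> x i \<in> U"
  shows "f (\<Sum>i\<in>K. x i) = (\<Sum>i\<in>K. f (x i))"
  using assms(5)
proof (induction K rule: infinite_finite_induct)
  case (insert i K)
  interpret V: vector_space s by fact
  have "(\<Sum>i\<in>K. x i) \<in> U" by (rule V.subspace_sum[OF U]) (use insert in auto)
  with f insert show ?case by (auto simp: linear_on_def)
qed (use linear_on_0[OF vs U f] in auto)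

lemma vector_space_mult: "vector_space ((*) :: 'k::field \<Rightarrow> 'k \<Rightarrow> 'k)"
  by unfold_locales (auto simp: algebra_simps)

lemmas linear_form_sum = linear_on_sum[OF _ vector_space_mult]
lemmas linear_form_0 = linear_on_0[OF _ vector_space_mult]

lemma bilinear_form_on_add:
  assumes "bilinear_form_on s U B" "bilinear_form_on s U B'"
  shows "bilinear_form_on s U (\<lambda>p. B p + B' p)"
  using assms by (auto simp: bilinear_form_on_def linear_on_def algebra_simps)

lemma bilinear_form_on_scale:
  assumes "bilinear_form_on s U B"
  shows "bilinear_form_on s U (\<lambda>p. c * B p)"
  using assms by (auto simp: bilinear_form_on_def linear_on_def algebra_simps)

lemma bilinear_form_on_0: "bilinear_form_on s U (\<lambda>p. 0)"
  by (auto simp: bilinear_form_on_def linear_on_def)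

lemma bilinear_form_on_sum:
  assumes "\<And>k. k \<in> K \<Longrightarrow> bilinear_form_on s U (B k)"
  shows "bilinear_form_on s U (\<lambda>p. \<Sum>k\<in>K. B k p)"
  using assms
  by (induction K rule: infinite_finite_induct) (simp_all add: bilinear_form_on_add bilinear_form_on_0)

lemma bilinear_form_on_flip:
  "bilinear_form_on s U (\<lambda>(x, y). B (y, x)) \<longleftrightarrow> bilinear_form_on s U B"
  by (auto simp: bilinear_form_on_def)

lemma bilinear_form_on_compose:
  assumes "bilinear_form_on s U B" "linear_on s s U S" "linear_on s s U T" "S ` U \<subseteq> U" "T ` U \<subseteq> U"
  shows "bilinear_form_on s U (\<lambda>(x, y). B (S x, T y))"
  using assms by (auto simp: bilinear_form_on_def linear_on_def image_subset_iff)

text \<open>The scalars of a linear combination of pure tensors are absorbed into the left factors.\<close>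

lemma tensor_space_sum:
  assumes vs: "vector_space s" and U: "module.subspace s U" and t: "t \<in> tensor_space s U"
  obtains n :: nat and x y where
    "\<And>i. i < n \<Longrightarrow> x i \<in> U" "\<And>i. i < n \<Longrightarrow> y i \<in> U"
    "t = (\<Sum>i<n. tensor s U (x i) (y i))"
proof -
  interpret V: vector_space s by fact
  have "\<exists>(n::nat) x y. (\<forall>i<n. x i \<in> U \<and> y i \<in> U) \<and> t = (\<Sum>i<n. tensor s U (x i) (y i))"
    using t unfolding tensor_space_def
  proof (induction rule: fun_vs.span_induct_alt)
    case base
    show ?case by (intro exI[of _ 0]) auto
  next
    case (step c u t)
    from step(1) obtain a b where ab: "a \<in> U" "b \<in> U" "u = tensor s U a b" by auto
    have u: "fscale c u = tensor s U (s c a) b"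
      using ab by (auto simp: tensor_def fscale_def fun_eq_iff bilinear_form_on_def linear_on_def)
    from step(2) obtain n x y
      where xy: "\<forall>i<(n::nat). x i \<in> U \<and> y i \<in> U" "t = (\<Sum>i<n. tensor s U (x i) (y i))" by blast
    show ?case
      by (rule exI[of _ "Suc n"], rule exI[of _ "x(n := s c a)"], rule exI[of _ "y(n := b)"])
        (use xy ab u V.subspace_scale[OF U] in \<open>auto simp: less_Suc_eq add.commute\<close>)
  qed
  with that show thesis by blast
qed

lemma sum_tensor_eval:
  "(\<Sum>i\<in>K. tensor s U (x i) (y i)) = (\<lambda>B. if bilinear_form_on s U B then \<Sum>i\<in>K. B (x i, y i) else 0)"
  by (induction K rule: infinite_finite_induct) (auto simp: fun_eq_iff tensor_def zero_fun_def)

lemma tensor_in_space: "x \<in> U \<Longrightarrow> y \<in> U \<Longrightarrow> tensor s U x y \<in> tensor_space s U"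
  unfolding tensor_space_def by (rule fun_vs.span_base) auto

lemma subspace_tensor_space: "fun_vs.subspace (tensor_space s U)"
  unfolding tensor_space_def by (rule fun_vs.subspace_span)

text \<open>A tensor is a linear functional on bilinear forms.\<close>

lemma tensor_space_add:
  assumes "t \<in> tensor_space s U" "bilinear_form_on s U B" "bilinear_form_on s U B'"
  shows "t (\<lambda>p. B p + B' p) = t B + t B'"
  using assms(1) unfolding tensor_space_def
  by (induction rule: fun_vs.span_induct_alt)
    (use assms bilinear_form_on_add[OF assms(2,3)] in \<open>auto simp: tensor_def fscale_def algebra_simps\<close>)

lemma tensor_space_scale:
  assumes "t \<in> tensor_space s U" "bilinear_form_on s U B"
  shows "t (\<lambda>p. c * B p) = c * t B"
  using assms(1) unfolding tensor_space_def
  by (induction rule: fun_vs.span_induct_alt)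
    (use assms bilinear_form_on_scale[OF assms(2)] in \<open>auto simp: tensor_def fscale_def algebra_simps\<close>)

lemma tensor_space_sum_form:
  assumes "t \<in> tensor_space s U" "\<And>k. k \<in> K \<Longrightarrow> bilinear_form_on s U (B k)"
  shows "t (\<lambda>p. \<Sum>k\<in>K. B k p) = (\<Sum>k\<in>K. t (B k))"
proof -
  have 0: "t (\<lambda>p. 0) = 0"
    using tensor_space_scale[OF assms(1) bilinear_form_on_0, of 0] by simp
  show ?thesis
    using assms(2)
    by (induction K rule: infinite_finite_induct)
      (simp_all add: 0 tensor_space_add[OF assms(1)] bilinear_form_on_sum)
qed

text \<open>
  For a space \<open>U\<close> of functions, a sum of tensors \<open>g k \<otimes> w k\<close> in \<open>U \<otimes> W\<close> is zero, that is, every bilinear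
  form \<open>B\<close> vanishes on it, as soon as its evaluation at each point in the first factor is zero.
  Induction on the number of summands: if \<open>g l\<close> does not vanish at \<open>x\<close>, then the equation at \<open>x\<close>
  expresses \<open>w l\<close> by the other \<open>w k\<close>.
\<close>

lemma bilinear_sum_eq_0:
  fixes g :: "'i \<Rightarrow> 'x \<Rightarrow> 'k::field" and w :: "'i \<Rightarrow> 'y \<Rightarrow> 'k"
  assumes "finite K" "\<And>k. k \<in> K \<Longrightarrow> g k \<in> U" "\<And>k. k \<in> K \<Longrightarrow> w k \<in> W"
    and U: "fun_vs.subspace U" and W: "fun_vs.subspace W"
    and B1: "\<And>v. v \<in> W \<Longrightarrow> linear_on fscale (*) U (\<lambda>u. B u v)"
    and B2: "\<And>u. u \<in> U \<Longrightarrow> linear_on fscale (*) W (\<lambda>v. B u v)"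
    and "\<And>x. (\<Sum>k\<in>K. fscale (g k x) (w k)) = 0"
  shows "(\<Sum>k\<in>K. B (g k) (w k)) = 0"
  using assms(1-3,8)
proof (induction "card K" arbitrary: K g)
  case 0
  then show ?case by simp
next
  case (Suc n)
  note vs = fun_vs.vector_space_axioms
  show ?case
  proof (cases "\<forall>k\<in>K. g k = 0")
    case True
    have "B (g k) (w k) = 0" if "k \<in> K" for k
      using True linear_form_0[OF vs U B1[OF Suc.prems(3)[OF that]]] that by auto
    then show ?thesis by simp
  next
    case False
    then obtain l x where l: "l \<in> K" "g l x \<noteq> 0" by (auto simp: fun_eq_iff)
    define K' where "K' = K - {l}"
    define c where "c k = g k x / g l x" for k
    have K: "K = insert l K'" "l \<notin> K'" "finite K'" using l Suc.prems(1) by (auto simp: K'_def)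
    have wl: "w l y = - (\<Sum>k\<in>K'. c k * w k y)" for y
    proof -
      have "(\<Sum>k\<in>K. fscale (g k x) (w k)) y = 0" using Suc.prems(4) by simp
      then have "g l x * w l y + (\<Sum>k\<in>K'. g k x * w k y) = 0"
        using K by (simp add: fscale_def sum_fun_apply)
      then have "w l y = - (\<Sum>k\<in>K'. g k x * w k y) / g l x"
        using l(2) by (simp add: field_simps eq_neg_iff_add_eq_0)
      then show ?thesis by (simp add: c_def sum_divide_distrib)
    qed
    have wl': "w l = (\<Sum>k\<in>K'. fscale (- c k) (w k))"
      by (auto simp: fun_eq_iff sum_fun_apply wl fscale_def sum_negf)
    define g' where "g' k = g k + fscale (- c k) (g l)" for k
    have inU: "g k \<in> U" "fscale a (g k) \<in> U" if "k \<in> K" for k a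
      using Suc.prems(2)[OF that] fun_vs.subspace_scale[OF U] by auto
    have inW: "w k \<in> W" "fscale a (w k) \<in> W" if "k \<in> K" for k a
      using Suc.prems(3)[OF that] fun_vs.subspace_scale[OF W] by auto
    have "(\<Sum>k\<in>K'. B (g' k) (w k)) = 0"
    proof (rule Suc.hyps(1))
      show "n = card K'" using Suc.hyps(2) K by simp
      show "finite K'" by fact
      show "g' k \<in> U" if "k \<in> K'" for k
        unfolding g'_def using that K by (intro fun_vs.subspace_add[OF U] inU) auto
      show "w k \<in> W" if "k \<in> K'" for k using that K inW by auto
      show "(\<Sum>k\<in>K'. fscale (g' k z) (w k)) = 0" for z
      proof
        fix y
        have "(\<Sum>k\<in>K. fscale (g k z) (w k)) y = 0" using Suc.prems(4) by simp
        then have "g l z * w l y + (\<Sum>k\<in>K'. g k z * w k y) = 0"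
          using K by (simp add: fscale_def sum_fun_apply)
        then show "(\<Sum>k\<in>K'. fscale (g' k z) (w k)) y = 0 y"
          by (simp add: wl g'_def fscale_def sum_fun_apply algebra_simps sum_subtractf sum_distrib_left)
      qed
    qed
    moreover have "B (g' k) (w k) = B (g k) (w k) - c k * B (g l) (w k)" if "k \<in> K'" for k
    proof -
      have "k \<in> K" using that K by auto
      note B = B1[OF inW(1)[OF this], unfolded linear_on_def]
      have "B (g' k) (w k) = B (g k) (w k) + B (fscale (- c k) (g l)) (w k)"
        unfolding g'_def using B inU \<open>k \<in> K\<close> l by blast
      also have "B (fscale (- c k) (g l)) (w k) = - c k * B (g l) (w k)"
        using B inU \<open>k \<in> K\<close> l by blast
      finally show ?thesis by simp
    qed
    moreover have "B (g l) (w l) = - (\<Sum>k\<in>K'. c k * B (g l) (w k))"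
    proof -
      have "B (g l) (w l) = (\<Sum>k\<in>K'. B (g l) (fscale (- c k) (w k)))"
        unfolding wl' by (rule linear_form_sum[OF vs W B2[OF inU(1)[OF l(1)]]], rule inW(2)) (use K in auto)
      also have "\<dots> = (\<Sum>k\<in>K'. - c k * B (g l) (w k))"
        using B2[OF inU(1)[OF l(1)]] inW(1) K unfolding linear_on_def by (intro sum.cong refl) blast
      finally show ?thesis by (simp add: sum_negf)
    qed
    ultimately show ?thesis
      using K by (simp add: sum_subtractf)
  qed
qed

section \<open>Bilinear forms of finite rank\<close>

text \<open>The functions of two variables that are finite sums of products \<open>g x * h y\<close>; no linearity is required.\<close>

definition finite_rank :: "('v \<times> 'v \<Rightarrow> 'k::field) \<Rightarrow> bool" where
  "finite_rank F \<longleftrightarrow> F \<in> fun_vs.span {form_tensor g h | g h. True}"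

lemma bilinear_pairing: "bilinear_form_on fscale U (\<lambda>(g, h). g \<xi> * h \<eta>)"
  by (auto simp: bilinear_form_on_def linear_on_def fscale_def algebra_simps)

lemma tensor_form_tensor: "tensor_form (tensor fscale U g h) = form_tensor g h"
  by (auto simp: tensor_form_def tensor_def bilinear_pairing form_tensor_def)

lemma linear_tensor_form: "Vector_Spaces.linear fscale fscale tensor_form"
  by unfold_locales (auto simp: tensor_form_def fscale_def fun_eq_iff)

lemma tensor_form_add: "tensor_form (t + t') = tensor_form t + tensor_form t'"
  by (auto simp: tensor_form_def)

lemma tensor_form_diff: "tensor_form (t - t') = tensor_form t - tensor_form t'"
  by (auto simp: tensor_form_def)

lemma tensor_form_minus: "tensor_form (- t) = - tensor_form t"
  by (auto simp: tensor_form_def)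

lemma tensor_form_scale: "tensor_form (fscale c t) = fscale c (tensor_form t)"
  by (auto simp: tensor_form_def fscale_def)

lemma tensor_form_image:
  "tensor_form ` tensor_space fscale U = fun_vs.span {form_tensor g h | g h. g \<in> U \<and> h \<in> U}"
proof -
  interpret T: Vector_Spaces.linear fscale fscale tensor_form by (rule linear_tensor_form)
  have "tensor_form ` {tensor fscale U g h | g h. g \<in> U \<and> h \<in> U} =
      {form_tensor g h | g h. g \<in> U \<and> h \<in> U}"
    by (force simp: tensor_form_tensor image_iff intro: tensor_form_tensor[symmetric])
  then show ?thesis
    unfolding tensor_space_def by (simp flip: T.span_image)
qed

lemma tensor_form_sum:
  "tensor_form (\<Sum>i\<in>K. tensor fscale U (g i) (h i)) (\<xi>, \<eta>) = (\<Sum>i\<in>K. g i \<xi> * h i \<eta>)"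
  by (simp add: sum_tensor_eval tensor_form_def bilinear_pairing)

text \<open>\<open>U \<otimes> U\<close> embeds into the bilinear forms when \<open>U\<close> consists of functions.\<close>

lemma tensor_form_eq_0:
  assumes U: "fun_vs.subspace U" and t: "t \<in> tensor_space fscale U" and 0: "tensor_form t = 0"
  shows "t = 0"
proof -
  from tensor_space_sum[OF fun_vs.vector_space_axioms U t] obtain n :: nat and x y
    where xy: "\<And>i. i < n \<Longrightarrow> x i \<in> U" "\<And>i. i < n \<Longrightarrow> y i \<in> U"
      "t = (\<Sum>i<n. tensor fscale U (x i) (y i))" by blast
  have "(\<Sum>i<n. fscale (x i \<xi>) (y i)) = 0" for \<xi>
  proof
    fix \<eta>
    have "(\<Sum>i<n. x i \<xi> * y i \<eta>) = 0"
      using 0 tensor_form_sum[of U x y "{..<n}" \<xi> \<eta>] xy(3) by simp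
    then show "(\<Sum>i<n. fscale (x i \<xi>) (y i)) \<eta> = 0 \<eta>" by (simp add: sum_fun_apply fscale_def)
  qed
  then have "(\<Sum>i<n. B (x i, y i)) = 0" if "bilinear_form_on fscale U B" for B
    by (intro bilinear_sum_eq_0[where U = U and W = U and B = "\<lambda>u v. B (u, v)"])
      (use that xy U in \<open>auto simp: bilinear_form_on_def\<close>)
  then show ?thesis
    unfolding xy(3) sum_tensor_eval by (auto simp: fun_eq_iff)
qed

lemma tensor_form_inject:
  assumes U: "fun_vs.subspace U" and "t \<in> tensor_space fscale U" "t' \<in> tensor_space fscale U"
    and "tensor_form t = tensor_form t'"
  shows "t = t'"
  using tensor_form_eq_0[OF U, of "t - t'"] assms fun_vs.subspace_diff[OF subspace_tensor_space]
  by (auto simp: tensor_form_diff)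

lemma finite_rank_0: "finite_rank 0"
  unfolding finite_rank_def by (rule fun_vs.span_zero)

lemma finite_rank_add: "finite_rank F \<Longrightarrow> finite_rank G \<Longrightarrow> finite_rank (F + G)"
  unfolding finite_rank_def by (rule fun_vs.span_add)

lemma finite_rank_diff: "finite_rank F \<Longrightarrow> finite_rank G \<Longrightarrow> finite_rank (F - G)"
  unfolding finite_rank_def by (rule fun_vs.span_diff)

lemma finite_rank_scale: "finite_rank F \<Longrightarrow> finite_rank (fscale c F)"
  unfolding finite_rank_def by (rule fun_vs.span_scale)

lemma finite_rankI:
  assumes "\<And>x y. F (x, y) = (\<Sum>k\<in>K. g k x * h k y)"
  shows "finite_rank F"
proof -
  have "F = (\<Sum>k\<in>K. form_tensor (g k) (h k))"
    using assms by (auto simp: fun_eq_iff form_tensor_def sum_fun_apply)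
  then show ?thesis
    unfolding finite_rank_def by (auto intro!: fun_vs.span_sum intro: fun_vs.span_base)
qed

lemma finite_rank_sum:
  assumes "finite_rank F"
  shows "\<exists>(n::nat) g h. \<forall>x y. F (x, y) = (\<Sum>k<n. g k x * h k y)"
proof -
  have "F \<in> tensor_form ` tensor_space fscale UNIV"
    using assms unfolding finite_rank_def tensor_form_image by simp
  then obtain t where t: "t \<in> tensor_space fscale UNIV" "F = tensor_form t" by blast
  from tensor_space_sum[OF fun_vs.vector_space_axioms fun_vs.subspace_UNIV t(1)]
  obtain n :: nat and g h where "t = (\<Sum>i<n. tensor fscale UNIV (g i) (h i))" by blast
  with t(2) have "\<forall>x y. F (x, y) = (\<Sum>k<n. g k x * h k y)" by (simp add: tensor_form_sum)
  then show ?thesis by blast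
qed

lemma finite_rank_comp:
  assumes "finite_rank F"
  shows "finite_rank (\<lambda>(x, y). a x * b y * F (u x, v y))"
proof -
  obtain n :: nat and g h where F: "\<forall>x y. F (x, y) = (\<Sum>k<n. g k x * h k y)"
    using finite_rank_sum[OF assms] by blast
  show ?thesis
    by (rule finite_rankI[of _ "\<lambda>k x. a x * g k (u x)" "\<lambda>k y. b y * h k (v y)" "{..<n}"])
      (simp add: F[rule_format] sum_distrib_left mult_ac)
qed

lemma finite_rank_flip:
  assumes "finite_rank F"
  shows "finite_rank (\<lambda>(x, y). F (y, x))"
proof -
  obtain n :: nat and g h where F: "\<forall>x y. F (x, y) = (\<Sum>k<n. g k x * h k y)"
    using finite_rank_sum[OF assms] by blast
  show ?thesis
    by (rule finite_rankI[of _ h g "{..<n}"]) (simp add: F[rule_format] mult_ac)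
qed

text \<open>
  A form of finite rank is a finite sum of products of its columns and its rows. This is Wedderburn's
  rank reduction: subtracting \<open>F (x, b) F (a, y) / F (a, b)\<close> from \<open>F\<close> lowers the
  number of summands and leaves rows and columns in the spans of those of \<open>F\<close>.
\<close>

lemma rank_reduction:
  fixes g :: "'i \<Rightarrow> 'v \<Rightarrow> 'k::field"
  assumes "finite K" "\<And>x y. F (x, y) = (\<Sum>k\<in>K. g k x * h k y)"
    and "fun_vs.subspace C" "fun_vs.subspace R"
    and "\<And>y. (\<lambda>x. F (x, y)) \<in> C" "\<And>x. (\<lambda>y. F (x, y)) \<in> R"
  shows "F \<in> fun_vs.span {form_tensor u v | u v. u \<in> C \<and> v \<in> R}"
  using assms(1,2,5,6)
proof (induction "card K" arbitrary: K g h F)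
  case 0
  then have "F = 0" by (auto simp: fun_eq_iff)
  show ?case unfolding \<open>F = 0\<close> by (rule fun_vs.span_zero)
next
  case (Suc n)
  show ?case
  proof (cases "F = 0")
    case True
    show ?thesis unfolding True by (rule fun_vs.span_zero)
  next
    case False
    then obtain a b where ab: "F (a, b) \<noteq> 0" by (auto simp: fun_eq_iff)
    have "\<exists>l\<in>K. g l a \<noteq> 0"
      by (rule ccontr) (use ab Suc.prems(2)[of a b] in auto)
    then obtain l where l: "l \<in> K" "g l a \<noteq> 0" by blast
    define K' where "K' = K - {l}"
    have K: "K = insert l K'" "l \<notin> K'" "finite K'" using l Suc.prems(1) by (auto simp: K'_def)
    define c where "c = F (a, b)"
    define g' where "g' k x = g k x - g k a / g l a * g l x" for k x
    define h' where "h' k y = h k y - h k b / c * F (a, y)" for k y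
    define F' where "F' = F - fscale (1 / c) (form_tensor (\<lambda>x. F (x, b)) (\<lambda>y. F (a, y)))"
    have hl: "h l y = (F (a, y) - (\<Sum>k\<in>K'. g k a * h k y)) / g l a" for y
      using Suc.prems(2)[of a y] K l by (simp add: field_simps)
    have F: "F (x, y) = g l x / g l a * F (a, y) + (\<Sum>k\<in>K'. g' k x * h k y)" for x y
    proof -
      have "(\<Sum>k\<in>K'. g' k x * h k y) =
          (\<Sum>k\<in>K'. g k x * h k y) - g l x / g l a * (\<Sum>k\<in>K'. g k a * h k y)"
        by (simp add: g'_def algebra_simps sum_subtractf sum_distrib_left)
      moreover have "F (x, y) = g l x * h l y + (\<Sum>k\<in>K'. g k x * h k y)"
        using Suc.prems(2) K by simp
      ultimately show ?thesis by (simp add: hl diff_divide_distrib right_diff_distrib)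
    qed
    have F': "F' (x, y) = (\<Sum>k\<in>K'. g' k x * h' k y)" for x y
    proof -
      have "F' (x, y) = F (x, y) - F (x, b) / c * F (a, y)"
        by (simp add: F'_def fscale_def form_tensor_def)
      also have "\<dots> = (\<Sum>k\<in>K'. g' k x * h k y) - (\<Sum>k\<in>K'. g' k x * h k b) / c * F (a, y)"
        unfolding F[of x y] F[of x b] using ab by (simp add: c_def field_simps)
      also have "\<dots> = (\<Sum>k\<in>K'. g' k x * h' k y)"
        by (simp add: h'_def algebra_simps sum_subtractf sum_distrib_left sum_divide_distrib)
      finally show ?thesis .
    qed
    have "F' \<in> fun_vs.span {form_tensor u v | u v. u \<in> C \<and> v \<in> R}"
    proof (rule Suc.hyps(1)[of K', OF _ K(3), where g = g' and h = h'])
      show "n = card K'" using Suc.hyps(2) K by simp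
      show "F' (x, y) = (\<Sum>k\<in>K'. g' k x * h' k y)" for x y by (rule F')
      fix z
      have "(\<lambda>x. F' (x, z)) = (\<lambda>x. F (x, z)) - fscale (F (a, z) / c) (\<lambda>x. F (x, b))"
        by (auto simp: F'_def fscale_def form_tensor_def)
      then show "(\<lambda>x. F' (x, z)) \<in> C"
        using Suc.prems(3) assms(3) by (simp add: fun_vs.subspace_diff fun_vs.subspace_scale)
      have "(\<lambda>y. F' (z, y)) = (\<lambda>y. F (z, y)) - fscale (F (z, b) / c) (\<lambda>y. F (a, y))"
        by (auto simp: F'_def fscale_def form_tensor_def)
      then show "(\<lambda>y. F' (z, y)) \<in> R"
        using Suc.prems(4) assms(4) by (simp add: fun_vs.subspace_diff fun_vs.subspace_scale)
    qed
    moreover have "fscale (1 / c) (form_tensor (\<lambda>x. F (x, b)) (\<lambda>y. F (a, y))) \<in>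
        fun_vs.span {form_tensor u v | u v. u \<in> C \<and> v \<in> R}"
      using Suc.prems(3,4) by (intro fun_vs.span_scale fun_vs.span_base) auto
    ultimately show ?thesis
      unfolding F'_def using fun_vs.span_add by fastforce
  qed
qed

section \<open>Threefold tensors\<close>

lemma trilinear_form_onD:
  assumes "trilinear_form_on s U T"
  shows "x \<in> U \<Longrightarrow> bilinear_form_on s U (\<lambda>(u, v). T (x, u, v))"
    and "u \<in> U \<Longrightarrow> v \<in> U \<Longrightarrow> linear_on s (*) U (\<lambda>x. T (x, u, v))"
  using assms by (auto simp: trilinear_form_on_def bilinear_form_on_def)

lemma trilinear_form_on_cycle:
  "trilinear_form_on s U (\<lambda>(x, y, z). T (y, z, x)) \<longleftrightarrow> trilinear_form_on s U T"
  by (auto simp: trilinear_form_on_def)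

lemma trilinear_pairing: "trilinear_form_on fscale U (\<lambda>(g, h, l). g \<xi> * h \<eta> * l \<zeta>)"
  by (auto simp: trilinear_form_on_def linear_on_def fscale_def algebra_simps)

lemma linear_on_cong:
  assumes "vector_space s" "module.subspace s U"
    and "linear_on s s' U f" "\<And>x. x \<in> U \<Longrightarrow> g x = f x"
  shows "linear_on s s' U g"
proof -
  interpret V: vector_space s by fact
  show ?thesis
    using assms(3,4) V.subspace_add[OF assms(2)] V.subspace_scale[OF assms(2)]
    by (simp add: linear_on_def)
qed

text \<open>The threefold tensors on a space of functions are likewise determined by their values.\<close>

lemma trilinear_sum_eq_0:
  fixes a b c :: "'i \<Rightarrow> 'x \<Rightarrow> 'k::field"
  assumes K: "finite K" and U: "fun_vs.subspace U"
    and abc: "\<And>k. k \<in> K \<Longrightarrow> a k \<in> U" "\<And>k. k \<in> K \<Longrightarrow> b k \<in> U" "\<And>k. k \<in> K \<Longrightarrow> c k \<in> U"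
    and 0: "\<And>\<xi> \<eta> \<zeta>. (\<Sum>k\<in>K. a k \<xi> * b k \<eta> * c k \<zeta>) = 0"
    and T: "trilinear_form_on fscale U T"
  shows "(\<Sum>k\<in>K. T (a k, b k, c k)) = 0"
proof -
  define w where "w k = tensor fscale U (b k) (c k)" for k
  define B where "B x t = t (\<lambda>(u, v). T (x, u, v))" for x and t :: "('k, 'x \<Rightarrow> 'k) tensor2"
  note W = subspace_tensor_space[of fscale U]
  have w: "w k \<in> tensor_space fscale U" if "k \<in> K" for k
    unfolding w_def by (rule tensor_in_space) (use that abc in auto)
  have "(\<Sum>k\<in>K. B (a k) (w k)) = 0"
  proof (rule bilinear_sum_eq_0[OF K abc(1) w U W])
    show "linear_on fscale (*) U (\<lambda>x. B x t)" if t: "t \<in> tensor_space fscale U" for t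
      using t unfolding tensor_space_def
    proof (induction rule: fun_vs.span_induct_alt)
      case (step d t t')
      then obtain u v where uv: "u \<in> U" "v \<in> U" "t = tensor fscale U u v" by blast
      have eq: "B x (fscale d t + t') = d * T (x, u, v) + B x t'" if "x \<in> U" for x
        using uv trilinear_form_onD(1)[OF T that] by (simp add: B_def tensor_def fscale_def)
      have "linear_on fscale (*) U (\<lambda>x. d * T (x, u, v) + B x t')"
        using step(2) trilinear_form_onD(2)[OF T uv(1,2)] by (auto simp: linear_on_def algebra_simps)
      from linear_on_cong[OF fun_vs.vector_space_axioms U this eq] show ?case .
    qed (auto simp: B_def linear_on_def)
    show "linear_on fscale (*) (tensor_space fscale U) (B x)" for x
      by (auto simp: linear_on_def B_def fscale_def)
    show "(\<Sum>k\<in>K. fscale (a k \<xi>) (w k)) = 0" for \<xi>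
    proof (rule tensor_form_eq_0[OF U])
      show "(\<Sum>k\<in>K. fscale (a k \<xi>) (w k)) \<in> tensor_space fscale U"
        by (intro fun_vs.subspace_sum[OF W] fun_vs.subspace_scale[OF W] w)
      have "tensor_form (\<Sum>k\<in>K. fscale (a k \<xi>) (w k)) (\<eta>, \<zeta>) = (\<Sum>k\<in>K. a k \<xi> * b k \<eta> * c k \<zeta>)" for \<eta> \<zeta>
        by (simp add: tensor_form_def sum_fun_apply fscale_def w_def tensor_def bilinear_pairing mult_ac)
      then show "tensor_form (\<Sum>k\<in>K. fscale (a k \<xi>) (w k)) = 0"
        by (auto simp: 0)
    qed
  qed auto
  moreover have "B (a k) (w k) = T (a k, b k, c k)" if "k \<in> K" for k
    using trilinear_form_onD(1)[OF T abc(1)[OF that]] by (simp add: B_def w_def tensor_def)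
  ultimately show ?thesis by simp
qed

text \<open>A tensor on \<open>U\<close> only sees the values of a form on \<open>U\<close>.\<close>

lemma tensor_space_cong:
  assumes vs: "vector_space s" and U: "module.subspace s U" and t: "t \<in> tensor_space s U"
    and eq: "\<And>u v. u \<in> U \<Longrightarrow> v \<in> U \<Longrightarrow> B (u, v) = B' (u, v)"
  shows "t B = t B'"
proof -
  interpret V: vector_space s by fact
  have "bilinear_form_on s U B \<longleftrightarrow> bilinear_form_on s U B'"
    using V.subspace_add[OF U] V.subspace_scale[OF U] eq
    by (auto simp: bilinear_form_on_def linear_on_def)
  then have "tensor s U u v B = tensor s U u v B'" if "u \<in> U" "v \<in> U" for u v
    using eq that by (simp add: tensor_def)
  with t show ?thesis
    unfolding tensor_space_def
    by (induction rule: fun_vs.span_induct_alt) (auto simp: fscale_def)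
qed

lemma bilinear_id_tensor_cobracket:
  assumes vs: "vector_space s" and U: "module.subspace s U"
    and \<delta>: "\<And>x. x \<in> U \<Longrightarrow> \<delta> x \<in> tensor_space s U" "linear_on s fscale U \<delta>"
    and T: "trilinear_form_on s U T"
  shows "bilinear_form_on s U (\<lambda>(x, y). \<delta> y (\<lambda>(u, v). T (x, u, v)))"
proof -
  interpret V: vector_space s by fact
  have "\<delta> y (\<lambda>(u, v). T (x + x', u, v)) = \<delta> y (\<lambda>(u, v). T (x, u, v)) + \<delta> y (\<lambda>(u, v). T (x', u, v))"
    if "x \<in> U" "x' \<in> U" "y \<in> U" for x x' y
  proof -
    have "\<delta> y (\<lambda>(u, v). T (x + x', u, v)) =
        \<delta> y (\<lambda>p. (case p of (u, v) \<Rightarrow> T (x, u, v)) + (case p of (u, v) \<Rightarrow> T (x', u, v)))"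
      using trilinear_form_onD(2)[OF T] that
      by (intro tensor_space_cong[OF vs U \<delta>(1)]) (auto simp: linear_on_def)
    then show ?thesis
      using tensor_space_add[OF \<delta>(1) trilinear_form_onD(1)[OF T] trilinear_form_onD(1)[OF T]] that by simp
  qed
  moreover have "\<delta> y (\<lambda>(u, v). T (s c x, u, v)) = c * \<delta> y (\<lambda>(u, v). T (x, u, v))"
    if "x \<in> U" "y \<in> U" for x y c
  proof -
    have "\<delta> y (\<lambda>(u, v). T (s c x, u, v)) = \<delta> y (\<lambda>p. c * (case p of (u, v) \<Rightarrow> T (x, u, v)))"
      using trilinear_form_onD(2)[OF T] that
      by (intro tensor_space_cong[OF vs U \<delta>(1)]) (auto simp: linear_on_def)
    then show ?thesis
      using tensor_space_scale[OF \<delta>(1) trilinear_form_onD(1)[OF T]] that by simp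
  qed
  ultimately show ?thesis
    using \<delta>(2) by (auto simp: bilinear_form_on_def linear_on_def fscale_def)
qed

lemma id_tensor_cobracket_sum:
  assumes vs: "vector_space s" and U: "module.subspace s U"
    and \<delta>: "\<And>x. x \<in> U \<Longrightarrow> \<delta> x \<in> tensor_space s U" "linear_on s fscale U \<delta>"
    and t: "t \<in> tensor_space s U"
  shows "\<exists>(K :: (nat \<times> nat) set) a b c. finite K \<and> (\<forall>k\<in>K. a k \<in> U \<and> b k \<in> U \<and> c k \<in> U) \<and>
    (\<forall>T. trilinear_form_on s U T \<longrightarrow> id_tensor_cobracket s U \<delta> t T = (\<Sum>k\<in>K. T (a k, b k, c k)))"
proof -
  from tensor_space_sum[OF vs U t] obtain n :: nat and x y
    where xy: "\<And>i. i < n \<Longrightarrow> x i \<in> U" "\<And>i. i < n \<Longrightarrow> y i \<in> U"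
      "t = (\<Sum>i<n. tensor s U (x i) (y i))" by blast
  have "\<exists>(m::nat) b c. (\<forall>j<m. b j \<in> U \<and> c j \<in> U) \<and> \<delta> (y i) = (\<Sum>j<m. tensor s U (b j) (c j))"
    if "i < n" for i
    using tensor_space_sum[OF vs U \<delta>(1)[OF xy(2)[OF that]]] by metis
  then obtain m :: "nat \<Rightarrow> nat" and b c where bc:
    "\<And>i j. i < n \<Longrightarrow> j < m i \<Longrightarrow> b i j \<in> U \<and> c i j \<in> U"
    "\<And>i. i < n \<Longrightarrow> \<delta> (y i) = (\<Sum>j<m i. tensor s U (b i j) (c i j))"
    by metis
  define K where "K = (SIGMA i:{..<n}. {..<m i})"
  have "id_tensor_cobracket s U \<delta> t T = (\<Sum>(i, j)\<in>K. T (x i, b i j, c i j))"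
    if T: "trilinear_form_on s U T" for T
  proof -
    have "id_tensor_cobracket s U \<delta> t T = (\<Sum>i<n. \<delta> (y i) (\<lambda>(u, v). T (x i, u, v)))"
      using T bilinear_id_tensor_cobracket[OF vs U \<delta> T]
      by (simp add: id_tensor_cobracket_def xy(3) sum_tensor_eval)
    also have "\<dots> = (\<Sum>i<n. \<Sum>j<m i. T (x i, b i j, c i j))"
      by (intro sum.cong) (auto simp: bc(2) sum_tensor_eval trilinear_form_onD(1)[OF T] xy(1))
    finally show ?thesis by (simp add: K_def sum.Sigma)
  qed
  then show ?thesis
    by (intro exI[of _ K] exI[of _ "\<lambda>(i, j). x i"] exI[of _ "\<lambda>(i, j). b i j"] exI[of _ "\<lambda>(i, j). c i j"])
      (auto simp: K_def xy bc(1) case_prod_unfold)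
qed

section \<open>The dual of a Lie bialgebra\<close>

text \<open>A Lie algebra on a whole type, with its functionals regarded as functions.\<close>

locale lie_algebra =
  fixes s :: "'k::field \<Rightarrow> 'v::ab_group_add \<Rightarrow> 'v" and br :: "'v \<Rightarrow> 'v \<Rightarrow> 'v"
  assumes lie_algebra: "lie_algebra_on s UNIV br"
begin

lemma vs: "vector_space s"
  using lie_algebra by (simp add: lie_algebra_on_def)

lemma br_add: "br (x + y) z = br x z + br y z" "br z (x + y) = br z x + br z y"
  and br_scale: "br (s c x) z = s c (br x z)" "br z (s c x) = s c (br z x)"
  and br_self: "br x x = 0"
  using lie_algebra by (auto simp: lie_algebra_on_def linear_on_def)

lemma jacobi: "br x (br y z) + br y (br z x) + br z (br x y) = 0"
  using lie_algebra by (auto simp: lie_algebra_on_def)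

lemma br_skew: "br x y = - br y x"
proof -
  have "br (x + y) (x + y) = br x y + br y x"
    unfolding br_add by (simp add: br_self)
  then show ?thesis by (simp add: br_self eq_neg_iff_add_eq_0)
qed

lemma br_minus: "br x (- y) = - br x y"
  using br_add(2)[of x y "- y"] br_add(2)[of x 0 0] by (simp add: eq_neg_iff_add_eq_0 add.commute)

lemma ad_derivation: "br x (br y z) = br (br x y) z + br y (br x z)"
proof -
  have "br x (br y z) = - br y (br z x) - br z (br x y)"
    using jacobi[of x y z] by (simp add: eq_neg_iff_add_eq_0 algebra_simps)
  also have "\<dots> = br y (br x z) + br (br x y) z"
    using br_skew[of z x] br_skew[of z "br x y"] by (simp add: br_minus)
  finally show ?thesis by (simp add: add.commute)
qed

lemma dual_space_iff: "f \<in> dual_space s \<longleftrightarrow> linear_on s (*) UNIV f"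
proof -
  interpret V: vector_space s by (rule vs)
  show ?thesis
    unfolding dual_space_def Vector_Spaces.linear_def linear_on_def
      module_hom_def module_hom_axioms_def
    using V.vector_space_axioms vector_space_mult V.module_axioms
    by (auto simp: module_iff_vector_space)
qed

lemma dualD:
  assumes "f \<in> dual_space s"
  shows "f (x + y) = f x + f y" "f (s c x) = c * f x" "f (- x) = - f x" "f (x - y) = f x - f y" "f 0 = 0"
proof -
  interpret f: Vector_Spaces.linear s "(*)" f using assms by (simp add: dual_space_def)
  show "f (x + y) = f x + f y" "f (s c x) = c * f x" "f (- x) = - f x" "f (x - y) = f x - f y" "f 0 = 0"
    by (rule f.add f.scale f.neg f.diff f.zero)+
qed

lemma form_tensor_bilinear:
  "f \<in> dual_space s \<Longrightarrow> h \<in> dual_space s \<Longrightarrow> bilinear_form_on s UNIV (form_tensor f h)"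
  by (auto simp: bilinear_form_on_def linear_on_def form_tensor_def dualD algebra_simps)

lemma subspace_dual: "fun_vs.subspace (dual_space s)"
  by (rule fun_vs.subspaceI) (auto simp: dual_space_iff linear_on_def fscale_def algebra_simps)

text \<open>
  The functionals whose image under the dual of the bracket has finite rank, a priori as a function.
  They form the maximal good subspace: by the Jacobi identity this space is invariant under the
  coadjoint action, and by rank reduction the tensor can be formed of coadjoint translates of the
  functional itself, which are linear.
\<close>

definition finite_dual :: "('v \<Rightarrow> 'k) set" where
  "finite_dual = {f \<in> dual_space s. finite_rank (bracket_dual br f)}"

lemma bracket_dual_add: "bracket_dual br (f + g) = bracket_dual br f + bracket_dual br g"
  and bracket_dual_scale: "bracket_dual br (fscale c f) = fscale c (bracket_dual br f)"
  by (auto simp: bracket_dual_def fscale_def fun_eq_iff)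

lemma subspace_finite_dual: "fun_vs.subspace finite_dual"
proof (rule fun_vs.subspaceI)
  have "bracket_dual br (0 :: 'v \<Rightarrow> 'k) = 0" by (auto simp: bracket_dual_def fun_eq_iff)
  then have "finite_rank (bracket_dual br (0 :: 'v \<Rightarrow> 'k))" by (simp only: finite_rank_0)
  then show "0 \<in> finite_dual"
    using fun_vs.subspace_0[OF subspace_dual] by (simp add: finite_dual_def)
qed (use subspace_dual in \<open>auto simp: finite_dual_def bracket_dual_add bracket_dual_scale finite_rank_add
    finite_rank_scale fun_vs.subspace_add fun_vs.subspace_scale\<close>)

lemma finite_dual_coadjoint:
  assumes "f \<in> finite_dual"
  shows "(\<lambda>\<eta>. f (br \<xi> \<eta>)) \<in> finite_dual" "(\<lambda>\<eta>. f (br \<eta> \<xi>)) \<in> finite_dual"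
proof -
  have f: "f \<in> dual_space s" "finite_rank (bracket_dual br f)" using assms by (auto simp: finite_dual_def)
  have dual: "(\<lambda>\<eta>. f (br \<xi> \<eta>)) \<in> dual_space s"
    by (simp add: dual_space_iff linear_on_def br_add br_scale dualD[OF f(1)])
  have "bracket_dual br (\<lambda>\<eta>. f (br \<xi> \<eta>)) =
      (\<lambda>(\<eta>, \<zeta>). 1 * 1 * bracket_dual br f (br \<xi> \<eta>, \<zeta>)) + (\<lambda>(\<eta>, \<zeta>). 1 * 1 * bracket_dual br f (\<eta>, br \<xi> \<zeta>))"
    by (auto simp: bracket_dual_def fun_eq_iff ad_derivation[of \<xi>] dualD[OF f(1)])
  moreover have "finite_rank \<dots>"
    by (intro finite_rank_add finite_rank_comp f(2))
  ultimately show *: "(\<lambda>\<eta>. f (br \<xi> \<eta>)) \<in> finite_dual" using dual by (simp add: finite_dual_def)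
  have "(\<lambda>\<eta>. f (br \<eta> \<xi>)) = - (\<lambda>\<eta>. f (br \<xi> \<eta>))"
    using br_skew[of _ \<xi>] by (auto simp: fun_eq_iff dualD[OF f(1)])
  then show "(\<lambda>\<eta>. f (br \<eta> \<xi>)) \<in> finite_dual"
    using fun_vs.subspace_neg[OF subspace_finite_dual *] by simp
qed

lemma finite_dual_tensor:
  assumes "f \<in> finite_dual"
  shows "\<exists>t \<in> tensor_space fscale finite_dual. tensor_form t = bracket_dual br f"
proof -
  from assms have "finite_rank (bracket_dual br f)" by (simp add: finite_dual_def)
  then obtain n :: nat and g h where "\<forall>x y. bracket_dual br f (x, y) = (\<Sum>k<n. g k x * h k y)"
    using finite_rank_sum by blast
  then have "bracket_dual br f \<in> fun_vs.span {form_tensor u v | u v. u \<in> finite_dual \<and> v \<in> finite_dual}"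
    by (intro rank_reduction[of "{..<n}" _ g h, OF _ _ subspace_finite_dual subspace_finite_dual])
      (use finite_dual_coadjoint[OF assms] in \<open>simp_all add: bracket_dual_def\<close>)
  then show ?thesis
    by (auto simp flip: tensor_form_image)
qed

lemma maximal_good_subspace_eq: "maximal_good_subspace s br = finite_dual"
proof (rule equalityI)
  have "U \<subseteq> finite_dual" if "good_subspace s br U" for U
  proof
    fix f assume "f \<in> U"
    with that have f: "f \<in> dual_space s" "bracket_dual br f \<in> tensor_form ` tensor_space fscale U"
      by (auto simp: good_subspace_def)
    then have "finite_rank (bracket_dual br f)"
      using fun_vs.span_mono[of "{form_tensor g h | g h. g \<in> U \<and> h \<in> U}" "{form_tensor g h | g h. True}"]
      unfolding finite_rank_def tensor_form_image by blast
    with f show "f \<in> finite_dual" by (simp add: finite_dual_def)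
  qed
  then show "maximal_good_subspace s br \<subseteq> finite_dual"
    unfolding maximal_good_subspace_def by (intro fun_vs.span_minimal subspace_finite_dual) auto
  have "good_subspace s br finite_dual"
    unfolding good_subspace_def
    using subspace_finite_dual finite_dual_tensor by (force simp: finite_dual_def)
  then show "finite_dual \<subseteq> maximal_good_subspace s br"
    unfolding maximal_good_subspace_def by (intro order_trans[OF _ fun_vs.span_superset]) auto
qed

lemma dual_cobracket:
  assumes "f \<in> finite_dual"
  shows "dual_cobracket s br f \<in> tensor_space fscale finite_dual"
    and "tensor_form (dual_cobracket s br f) = bracket_dual br f"
proof -
  have "\<exists>!t. t \<in> tensor_space fscale finite_dual \<and> tensor_form t = bracket_dual br f"
    using finite_dual_tensor[OF assms] tensor_form_inject[OF subspace_finite_dual] by metis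
  from theI'[OF this]
  show "dual_cobracket s br f \<in> tensor_space fscale finite_dual"
    "tensor_form (dual_cobracket s br f) = bracket_dual br f"
    by (simp_all add: dual_cobracket_def maximal_good_subspace_eq)
qed

lemma dual_cobracket_unique:
  assumes "f \<in> finite_dual" "t \<in> tensor_space fscale finite_dual"
  shows "tensor_form t = bracket_dual br f \<longleftrightarrow> t = dual_cobracket s br f"
  using tensor_form_inject[OF subspace_finite_dual assms(2)] dual_cobracket[OF assms(1)] by metis

lemma tensor_form_dual_cobracket:
  "f \<in> finite_dual \<Longrightarrow> tensor_form (dual_cobracket s br f) (\<xi>, \<eta>) = f (br \<xi> \<eta>)"
  by (simp add: dual_cobracket bracket_dual_def)

lemma dual_cobracket_sum:
  assumes "f \<in> finite_dual"
  shows "\<exists>(n::nat) g h. (\<forall>i<n. g i \<in> finite_dual \<and> h i \<in> finite_dual) \<and>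
    dual_cobracket s br f = (\<Sum>i<n. tensor fscale finite_dual (g i) (h i)) \<and>
    (\<forall>\<xi> \<eta>. f (br \<xi> \<eta>) = (\<Sum>i<n. g i \<xi> * h i \<eta>))"
proof -
  from tensor_space_sum[OF fun_vs.vector_space_axioms subspace_finite_dual dual_cobracket(1)[OF assms]]
  obtain n :: nat and g h where gh:
    "\<And>i. i < n \<Longrightarrow> g i \<in> finite_dual" "\<And>i. i < n \<Longrightarrow> h i \<in> finite_dual"
    "dual_cobracket s br f = (\<Sum>i<n. tensor fscale finite_dual (g i) (h i))"
    by blast
  moreover have "f (br \<xi> \<eta>) = (\<Sum>i<n. g i \<xi> * h i \<eta>)" for \<xi> \<eta>
    using tensor_form_dual_cobracket[OF assms, of \<xi> \<eta>] by (simp add: gh(3) tensor_form_sum)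
  ultimately show ?thesis by blast
qed

lemma linear_dual_cobracket: "linear_on fscale fscale finite_dual (dual_cobracket s br)"
  unfolding linear_on_def
proof (intro conjI ballI allI)
  note U = subspace_finite_dual and W = subspace_tensor_space[of fscale finite_dual]
  fix f g c assume f: "f \<in> finite_dual"
  have "fscale c f \<in> finite_dual" "fscale c (dual_cobracket s br f) \<in> tensor_space fscale finite_dual"
    using fun_vs.subspace_scale[OF U f] fun_vs.subspace_scale[OF W dual_cobracket(1)[OF f]] .
  from dual_cobracket_unique[OF this]
  show "dual_cobracket s br (fscale c f) = fscale c (dual_cobracket s br f)"
    by (simp add: tensor_form_scale bracket_dual_scale dual_cobracket(2)[OF f])
  assume g: "g \<in> finite_dual"
  have "f + g \<in> finite_dual"
    "dual_cobracket s br f + dual_cobracket s br g \<in> tensor_space fscale finite_dual"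
    using fun_vs.subspace_add[OF U f g]
      fun_vs.subspace_add[OF W dual_cobracket(1)[OF f] dual_cobracket(1)[OF g]] .
  from dual_cobracket_unique[OF this]
  show "dual_cobracket s br (f + g) = dual_cobracket s br f + dual_cobracket s br g"
    by (simp add: tensor_form_add bracket_dual_add dual_cobracket(2)[OF f] dual_cobracket(2)[OF g])
qed

lemma dual_cobracket_skew:
  assumes f: "f \<in> finite_dual"
  shows "tensor_flip (dual_cobracket s br f) = - dual_cobracket s br f"
proof -
  from dual_cobracket_sum[OF f] obtain n :: nat and g h where gh:
    "\<forall>i<n. g i \<in> finite_dual" "\<forall>i<n. h i \<in> finite_dual"
    "dual_cobracket s br f = (\<Sum>i<n. tensor fscale finite_dual (g i) (h i))" by blast
  have flip: "tensor_flip (dual_cobracket s br f) = (\<Sum>i<n. tensor fscale finite_dual (h i) (g i))"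
    unfolding gh(3) sum_tensor_eval by (auto simp: tensor_flip_def bilinear_form_on_flip)
  show ?thesis
  proof (rule tensor_form_inject[OF subspace_finite_dual])
    show "tensor_flip (dual_cobracket s br f) \<in> tensor_space fscale finite_dual"
      unfolding flip by (intro fun_vs.subspace_sum[OF subspace_tensor_space] tensor_in_space)
        (use gh in auto)
    show "- dual_cobracket s br f \<in> tensor_space fscale finite_dual"
      by (intro fun_vs.subspace_neg[OF subspace_tensor_space] dual_cobracket f)
    have "tensor_form (tensor_flip (dual_cobracket s br f)) (\<xi>, \<eta>) = - f (br \<xi> \<eta>)" for \<xi> \<eta>
    proof -
      have "tensor_form (tensor_flip (dual_cobracket s br f)) (\<xi>, \<eta>) =
          tensor_form (dual_cobracket s br f) (\<eta>, \<xi>)"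
        unfolding flip unfolding gh(3) by (simp add: tensor_form_sum mult.commute)
      also have "\<dots> = - f (br \<xi> \<eta>)"
        using f br_skew[of \<eta> \<xi>] by (simp add: tensor_form_dual_cobracket dualD finite_dual_def)
      finally show ?thesis .
    qed
    then show "tensor_form (tensor_flip (dual_cobracket s br f)) = tensor_form (- dual_cobracket s br f)"
      by (auto simp: fun_eq_iff tensor_form_minus tensor_form_dual_cobracket[OF f])
  qed
qed

text \<open>
  Paired with \<open>\<xi> \<otimes> \<eta> \<otimes> \<zeta>\<close>, the iterated cobracket of \<open>f\<close> is \<open>f\<close> of an iterated bracket, so the
  co-Jacobi identity of the dual is the Jacobi identity.
\<close>

lemma dual_cobracket_coassoc_form:
  assumes f: "f \<in> finite_dual"
  shows "id_tensor_cobracket fscale finite_dual (dual_cobracket s br) (dual_cobracket s br f)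
      (\<lambda>(g, h, l). g \<xi> * h \<eta> * l \<zeta>) = f (br \<xi> (br \<eta> \<zeta>))"
proof -
  note vs' = fun_vs.vector_space_axioms and U = subspace_finite_dual
  have "dual_cobracket s br y (\<lambda>(u, v). x \<xi> * u \<eta> * v \<zeta>) = x \<xi> * y (br \<eta> \<zeta>)"
    if "y \<in> finite_dual" for x y
    using tensor_space_scale[OF dual_cobracket(1)[OF that] bilinear_pairing, of "x \<xi>" \<eta> \<zeta>]
      tensor_form_dual_cobracket[OF that, of \<eta> \<zeta>]
    by (simp add: tensor_form_def case_prod_unfold mult.assoc)
  then have "dual_cobracket s br f (\<lambda>(x, y). dual_cobracket s br y (\<lambda>(u, v). x \<xi> * u \<eta> * v \<zeta>)) =
      dual_cobracket s br f (\<lambda>(x, y). x \<xi> * y (br \<eta> \<zeta>))"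
    by (intro tensor_space_cong[OF vs' U dual_cobracket(1)[OF f]]) auto
  also have "\<dots> = f (br \<xi> (br \<eta> \<zeta>))"
    using tensor_form_dual_cobracket[OF f, of \<xi> "br \<eta> \<zeta>"] by (simp add: tensor_form_def)
  finally show ?thesis by (simp add: id_tensor_cobracket_def trilinear_pairing)
qed

lemma dual_cobracket_cojacobi:
  assumes f: "f \<in> finite_dual"
  defines "\<theta> \<equiv> id_tensor_cobracket fscale finite_dual (dual_cobracket s br) (dual_cobracket s br f)"
  shows "\<theta> + tensor_cycle \<theta> + tensor_cycle (tensor_cycle \<theta>) = 0"
proof -
  note vs' = fun_vs.vector_space_axioms and U = subspace_finite_dual
  obtain K :: "(nat \<times> nat) set" and a b c where K: "finite K"
    and abc: "\<forall>k\<in>K. a k \<in> finite_dual \<and> b k \<in> finite_dual \<and> c k \<in> finite_dual"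
    and \<theta>: "\<forall>T. trilinear_form_on fscale finite_dual T \<longrightarrow> \<theta> T = (\<Sum>k\<in>K. T (a k, b k, c k))"
    using id_tensor_cobracket_sum[OF vs' U dual_cobracket(1) linear_dual_cobracket dual_cobracket(1)[OF f]]
    unfolding \<theta>_def by blast
  have form: "(\<Sum>k\<in>K. a k \<xi> * b k \<eta> * c k \<zeta>) = f (br \<xi> (br \<eta> \<zeta>))" for \<xi> \<eta> \<zeta>
    using \<theta>[rule_format, OF trilinear_pairing, of \<xi> \<eta> \<zeta>] dual_cobracket_coassoc_form[OF f, of \<xi> \<eta> \<zeta>]
    by (simp add: \<theta>_def)
  \<comment> \<open>the three summands of the cyclic sum of \<open>a \<otimes> b \<otimes> c\<close>, indexed by \<open>{..<3}\<close>\<close>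
  define A where "A = (\<lambda>(k, i::nat). if i = 0 then a k else if i = 1 then b k else c k)"
  define B where "B = (\<lambda>(k, i::nat). if i = 0 then b k else if i = 1 then c k else a k)"
  define C where "C = (\<lambda>(k, i::nat). if i = 0 then c k else if i = 1 then a k else b k)"
  have sum3: "(\<Sum>p\<in>K \<times> {..<3}. H (A p) (B p) (C p)) =
      (\<Sum>k\<in>K. H (a k) (b k) (c k)) + (\<Sum>k\<in>K. H (b k) (c k) (a k)) + (\<Sum>k\<in>K. H (c k) (a k) (b k))"
    for H :: "_ \<Rightarrow> _ \<Rightarrow> _ \<Rightarrow> 'k"
  proof -
    have "(\<Sum>p\<in>K \<times> {..<3}. H (A p) (B p) (C p)) = (\<Sum>k\<in>K. \<Sum>i<3. H (A (k, i)) (B (k, i)) (C (k, i)))"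
      by (simp add: sum.cartesian_product case_prod_unfold)
    also have "\<dots> = (\<Sum>k\<in>K. H (a k) (b k) (c k) + H (b k) (c k) (a k) + H (c k) (a k) (b k))"
      by (simp add: A_def B_def C_def numeral_3_eq_3)
    finally show ?thesis by (simp add: sum.distrib)
  qed
  have sum0: "(\<Sum>p\<in>K \<times> {..<3}. T (A p, B p, C p)) = 0" if T: "trilinear_form_on fscale finite_dual T" for T
  proof (rule trilinear_sum_eq_0[OF _ U _ _ _ _ T])
    fix \<xi> \<eta> \<zeta>
    have "(\<Sum>p\<in>K \<times> {..<3}. A p \<xi> * B p \<eta> * C p \<zeta>) =
        (\<Sum>k\<in>K. a k \<xi> * b k \<eta> * c k \<zeta>) + (\<Sum>k\<in>K. a k \<zeta> * b k \<xi> * c k \<eta>) + (\<Sum>k\<in>K. a k \<eta> * b k \<zeta> * c k \<xi>)"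
      unfolding sum3[of "\<lambda>x y z. x \<xi> * y \<eta> * z \<zeta>"] by (simp add: mult_ac)
    also have "\<dots> = f (br \<xi> (br \<eta> \<zeta>) + br \<eta> (br \<zeta> \<xi>) + br \<zeta> (br \<xi> \<eta>))"
      using f by (simp add: form dualD finite_dual_def)
    also have "\<dots> = 0"
      using f by (simp add: jacobi dualD finite_dual_def)
    finally show "(\<Sum>p\<in>K \<times> {..<3}. A p \<xi> * B p \<eta> * C p \<zeta>) = 0" .
  qed (use K abc in \<open>auto simp: A_def B_def C_def\<close>)
  have cyc: "\<theta> T + \<theta> (\<lambda>(x, y, z). T (y, z, x)) + \<theta> (\<lambda>(x, y, z). T (z, x, y)) = 0"
    if T: "trilinear_form_on fscale finite_dual T" for T
  proof -
    have "trilinear_form_on fscale finite_dual (\<lambda>(x, y, z). T (y, z, x))"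
      "trilinear_form_on fscale finite_dual (\<lambda>(x, y, z). T (z, x, y))"
      using T by (auto simp: trilinear_form_on_def)
    then show ?thesis
      using \<theta> T sum0[OF T] sum3[of "\<lambda>x y z. T (x, y, z)"] by simp
  qed
  have "(\<theta> + tensor_cycle \<theta> + tensor_cycle (tensor_cycle \<theta>)) T = 0" for T
  proof -
    have cc: "tensor_cycle (tensor_cycle \<theta>) T = \<theta> (\<lambda>(x, y, z). T (z, x, y))"
      by (simp add: tensor_cycle_def case_prod_unfold)
    show ?thesis
    proof (cases "trilinear_form_on fscale finite_dual T")
      case True
      then show ?thesis using cyc[OF True] cc by (simp add: tensor_cycle_def)
    next
      case False
      moreover from False have "\<not> trilinear_form_on fscale finite_dual (\<lambda>(x, y, z). T (z, x, y))"
        by (auto simp: trilinear_form_on_def)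
      ultimately show ?thesis
        using cc trilinear_form_on_cycle[of fscale finite_dual T]
        by (simp add: tensor_cycle_def \<theta>_def id_tensor_cobracket_def)
    qed
  qed
  then show ?thesis by (auto simp: fun_eq_iff)
qed

end

lemma tensor_map_sum:
  assumes "linear_on s s U S" "linear_on s s U T" "S ` U \<subseteq> U" "T ` U \<subseteq> U"
  shows "tensor_map s U S T (\<Sum>i\<in>K. tensor s U (x i) (y i)) = (\<Sum>i\<in>K. tensor s U (S (x i)) (T (y i)))"
  using bilinear_form_on_compose[OF _ assms] by (auto simp: tensor_map_def sum_tensor_eval)

text \<open>
  A Lie bialgebra on a whole type. Characteristic zero turns the skew-symmetry of the dual bracket
  into \<open>[f, f] = 0\<close>.
\<close>

locale lie_bialgebra = lie_algebra s br
  for s :: "'k::field_char_0 \<Rightarrow> 'v::ab_group_add \<Rightarrow> 'v" and br +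
  fixes \<delta> :: "'v \<Rightarrow> ('k, 'v) tensor2"
  assumes lie_bialgebra: "lie_bialgebra_on s UNIV br \<delta>"
begin

lemma lie_coalgebra: "lie_coalgebra_on s UNIV \<delta>"
  using lie_bialgebra by (simp add: lie_bialgebra_on_def)

lemma cobracket_space: "\<delta> x \<in> tensor_space s UNIV"
  using lie_coalgebra by (simp add: lie_coalgebra_on_def)

lemma dual_bracket_dual: "dual_bracket \<delta> f h \<in> dual_space s"
  using lie_coalgebra
  by (auto simp: dual_bracket_def dual_space_iff linear_on_def lie_coalgebra_on_def fscale_def)

lemma dual_bracket_skew: "dual_bracket \<delta> f h \<xi> = - dual_bracket \<delta> h f \<xi>"
proof -
  have "tensor_flip (\<delta> \<xi>) = - \<delta> \<xi>" using lie_coalgebra by (simp add: lie_coalgebra_on_def)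
  then have "tensor_flip (\<delta> \<xi>) (form_tensor h f) = (- \<delta> \<xi>) (form_tensor h f)" by simp
  then show ?thesis
    by (simp add: tensor_flip_def dual_bracket_def form_tensor_def mult.commute)
qed

lemma dual_bracket_sum_right:
  assumes f: "f \<in> dual_space s" and g: "\<And>k. k \<in> K \<Longrightarrow> g k \<in> dual_space s"
    and h: "\<And>x. h x = (\<Sum>k\<in>K. c k * g k x)"
  shows "dual_bracket \<delta> f h \<xi> = (\<Sum>k\<in>K. c k * dual_bracket \<delta> f (g k) \<xi>)"
proof -
  have "form_tensor f h = (\<lambda>p. \<Sum>k\<in>K. c k * form_tensor f (g k) p)"
    by (auto simp: form_tensor_def h sum_distrib_left mult_ac)
  moreover have "\<delta> \<xi> (\<lambda>p. \<Sum>k\<in>K. c k * form_tensor f (g k) p) = (\<Sum>k\<in>K. \<delta> \<xi> (\<lambda>p. c k * form_tensor f (g k) p))"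
    by (intro tensor_space_sum_form[OF cobracket_space] bilinear_form_on_scale form_tensor_bilinear f g)
  ultimately show ?thesis
    using tensor_space_scale[OF cobracket_space form_tensor_bilinear[OF f g]]
    by (simp add: dual_bracket_def)
qed

lemma dual_bracket_sum_left:
  assumes "f \<in> dual_space s" "\<And>k. k \<in> K \<Longrightarrow> g k \<in> dual_space s" "\<And>x. h x = (\<Sum>k\<in>K. c k * g k x)"
  shows "dual_bracket \<delta> h f \<xi> = (\<Sum>k\<in>K. c k * dual_bracket \<delta> (g k) f \<xi>)"
  using dual_bracket_sum_right[OF assms, of \<xi>]
  by (simp add: dual_bracket_skew[of h f] dual_bracket_skew[of _ f] sum_negf)

lemma dual_bracket_linear:
  assumes "f \<in> dual_space s"
  shows "linear_on fscale fscale (dual_space s) (dual_bracket \<delta> f)"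
    and "linear_on fscale fscale (dual_space s) (\<lambda>h. dual_bracket \<delta> h f)"
proof -
  have "dual_bracket \<delta> f (g + h) \<xi> = dual_bracket \<delta> f g \<xi> + dual_bracket \<delta> f h \<xi>"
    if "g \<in> dual_space s" "h \<in> dual_space s" for g h \<xi>
    using dual_bracket_sum_right[OF assms, of UNIV "\<lambda>b. if b then g else h" "g + h" "\<lambda>_. 1" \<xi>] that
    by (simp add: UNIV_bool add.commute)
  moreover have "dual_bracket \<delta> f (fscale c g) \<xi> = c * dual_bracket \<delta> f g \<xi>"
    if "g \<in> dual_space s" for g c \<xi>
    using dual_bracket_sum_right[OF assms, of "{()}" "\<lambda>_. g" "fscale c g" "\<lambda>_. c" \<xi>] that
    by (simp add: fscale_def)
  ultimately show "linear_on fscale fscale (dual_space s) (dual_bracket \<delta> f)"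
    "linear_on fscale fscale (dual_space s) (\<lambda>h. dual_bracket \<delta> h f)"
    by (auto simp: linear_on_def fun_eq_iff fscale_def dual_bracket_skew[of _ f])
qed

text \<open>The cocycle condition, paired with \<open>f \<otimes> h\<close>.\<close>

lemma dual_bracket_cocycle:
  assumes "f \<in> dual_space s" "h \<in> dual_space s"
  shows "dual_bracket \<delta> f h (br \<xi> \<eta>) =
    dual_bracket \<delta> (\<lambda>x. f (br \<xi> x)) h \<eta> + dual_bracket \<delta> f (\<lambda>x. h (br \<xi> x)) \<eta>
    - dual_bracket \<delta> (\<lambda>x. f (br \<eta> x)) h \<xi> - dual_bracket \<delta> f (\<lambda>x. h (br \<eta> x)) \<xi>"
proof -
  have "\<delta> (br \<xi> \<eta>) = tensor_action s UNIV br \<xi> (\<delta> \<eta>) - tensor_action s UNIV br \<eta> (\<delta> \<xi>)"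
    using lie_bialgebra by (simp add: lie_bialgebra_on_def)
  then show ?thesis
    using form_tensor_bilinear[OF assms]
    by (simp add: dual_bracket_def tensor_action_def tensor_map_def form_tensor_def)
qed

lemma finite_dual_subset: "finite_dual \<subseteq> dual_space s"
  by (auto simp: finite_dual_def)

text \<open>
  By the cocycle condition, the dual of the bracket maps \<open>[f, h]\<close> to a sum of four forms of the
  following kind, up to sign and exchange of \<open>\<xi>\<close> and \<open>\<eta>\<close>. Hence the finite dual is closed under the
  dual bracket.
\<close>

lemma finite_rank_dual_bracket_coadjoint:
  assumes f: "f \<in> finite_dual" and h: "h \<in> dual_space s"
  shows "finite_rank (\<lambda>(\<xi>, \<eta>). dual_bracket \<delta> (\<lambda>x. f (br \<xi> x)) h \<eta>)"
proof -
  obtain n :: nat and g l where gl: "\<forall>i<n. l i \<in> finite_dual"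
    and eq: "\<forall>\<xi> \<eta>. f (br \<xi> \<eta>) = (\<Sum>i<n. g i \<xi> * l i \<eta>)"
    using dual_cobracket_sum[OF f] by blast
  have "dual_bracket \<delta> (\<lambda>x. f (br \<xi> x)) h \<eta> = (\<Sum>i<n. g i \<xi> * dual_bracket \<delta> (l i) h \<eta>)" for \<xi> \<eta>
    by (rule dual_bracket_sum_left[OF h]) (use gl finite_dual_subset in \<open>auto simp: eq[rule_format]\<close>)
  then show ?thesis by (intro finite_rankI) simp
qed

lemma dual_bracket_finite_dual:
  assumes f: "f \<in> finite_dual" and h: "h \<in> finite_dual"
  shows "dual_bracket \<delta> f h \<in> finite_dual"
proof -
  have d: "f \<in> dual_space s" "h \<in> dual_space s" using f h finite_dual_subset by auto
  define F where "F = (\<lambda>(\<xi>, \<eta>). dual_bracket \<delta> (\<lambda>x. f (br \<xi> x)) h \<eta>)"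
  define H where "H = (\<lambda>(\<xi>, \<eta>). dual_bracket \<delta> (\<lambda>x. h (br \<xi> x)) f \<eta>)"
  have FH: "finite_rank F" "finite_rank H"
    unfolding F_def H_def using f h d by (auto intro: finite_rank_dual_bracket_coadjoint)
  have skew: "dual_bracket \<delta> f (\<lambda>x. h (br \<xi> x)) \<eta> = - H (\<xi>, \<eta>)" for \<xi> \<eta>
    by (simp add: H_def dual_bracket_skew[of f])
  have "bracket_dual br (dual_bracket \<delta> f h) =
      F - H - (\<lambda>(\<xi>, \<eta>). F (\<eta>, \<xi>)) + (\<lambda>(\<xi>, \<eta>). H (\<eta>, \<xi>))"
    by (auto simp: bracket_dual_def fun_eq_iff dual_bracket_cocycle[OF d] skew F_def)
  moreover have "finite_rank \<dots>"
    by (intro finite_rank_add finite_rank_diff finite_rank_flip FH)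
  ultimately show ?thesis by (simp add: finite_dual_def dual_bracket_dual)
qed

lemma dual_bracket_jacobi:
  assumes "f \<in> dual_space s" "g \<in> dual_space s" "h \<in> dual_space s"
  shows "dual_bracket \<delta> f (dual_bracket \<delta> g h) + dual_bracket \<delta> g (dual_bracket \<delta> h f) +
    dual_bracket \<delta> h (dual_bracket \<delta> f g) = 0"
proof
  fix \<xi>
  define t where "t = id_tensor_cobracket s UNIV \<delta> (\<delta> \<xi>)"
  define T where "T f g h = (\<lambda>(x, y, z). f x * g y * h z)" for f g h :: "'v \<Rightarrow> 'k"
  have tT: "t (T f g h) = dual_bracket \<delta> f (dual_bracket \<delta> g h) \<xi>"
    if d: "f \<in> dual_space s" "g \<in> dual_space s" "h \<in> dual_space s" for f g h
  proof -
    have "trilinear_form_on s UNIV (T f g h)"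
      using d by (auto simp: T_def trilinear_form_on_def linear_on_def dualD algebra_simps)
    moreover have "\<delta> y (\<lambda>(u, v). T f g h (x, u, v)) = f x * \<delta> y (form_tensor g h)" for x y
      using tensor_space_scale[OF cobracket_space form_tensor_bilinear[OF d(2,3)], of y "f x"]
      by (simp add: T_def form_tensor_def case_prod_unfold mult.assoc)
    ultimately show ?thesis
      by (simp add: t_def id_tensor_cobracket_def dual_bracket_def form_tensor_def)
  qed
  have "t + tensor_cycle t + tensor_cycle (tensor_cycle t) = 0"
    using lie_coalgebra by (simp add: lie_coalgebra_on_def t_def Let_def)
  then have "(t + tensor_cycle t + tensor_cycle (tensor_cycle t)) (T f g h) = 0" by simp
  then have "t (T f g h) + tensor_cycle t (T f g h) + tensor_cycle (tensor_cycle t) (T f g h) = 0"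
    by (simp only: plus_fun_apply)
  moreover have "tensor_cycle t (T f g h) = t (T h f g)" "tensor_cycle (tensor_cycle t) (T f g h) = t (T g h f)"
    by (simp_all add: tensor_cycle_def T_def case_prod_unfold mult_ac)
  ultimately show "(dual_bracket \<delta> f (dual_bracket \<delta> g h) + dual_bracket \<delta> g (dual_bracket \<delta> h f) +
      dual_bracket \<delta> h (dual_bracket \<delta> f g)) \<xi> = 0 \<xi>"
    using tT[of f g h] tT[of g h f] tT[of h f g] assms
    by (simp only: plus_fun_apply zero_fun_apply add.assoc add.commute add.left_commute)
qed

lemma linear_on_subset: "linear_on s1 s2 V f \<Longrightarrow> U \<subseteq> V \<Longrightarrow> linear_on s1 s2 U f"
  unfolding linear_on_def by blast

lemma dual_lie_algebra: "lie_algebra_on fscale finite_dual (dual_bracket \<delta>)"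
  unfolding lie_algebra_on_def
proof (intro conjI ballI)
  note sub = subsetD[OF finite_dual_subset]
  show "vector_space (fscale :: 'k \<Rightarrow> _)" by (rule fun_vs.vector_space_axioms)
  show "fun_vs.subspace finite_dual" by (rule subspace_finite_dual)
  fix f assume f: "f \<in> finite_dual"
  show "linear_on fscale fscale finite_dual (dual_bracket \<delta> f)"
    "linear_on fscale fscale finite_dual (\<lambda>h. dual_bracket \<delta> h f)"
    using dual_bracket_linear[OF sub[OF f]] finite_dual_subset by (auto intro: linear_on_subset)
  show "dual_bracket \<delta> f f = 0"
  proof
    show "dual_bracket \<delta> f f \<xi> = 0 \<xi>" for \<xi>
      using dual_bracket_skew[of f f \<xi>] by simp
  qed
  fix g assume g: "g \<in> finite_dual"
  show "dual_bracket \<delta> f g \<in> finite_dual" by (rule dual_bracket_finite_dual[OF f g])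
  fix h assume h: "h \<in> finite_dual"
  show "dual_bracket \<delta> f (dual_bracket \<delta> g h) + dual_bracket \<delta> g (dual_bracket \<delta> h f) +
      dual_bracket \<delta> h (dual_bracket \<delta> f g) = 0"
    using dual_bracket_jacobi f g h sub by blast
qed

lemma dual_lie_coalgebra: "lie_coalgebra_on fscale finite_dual (dual_cobracket s br)"
  unfolding lie_coalgebra_on_def Let_def
  using fun_vs.vector_space_axioms subspace_finite_dual dual_cobracket(1) linear_dual_cobracket
    dual_cobracket_skew dual_cobracket_cojacobi by auto

text \<open>
  Contracting \<open>f \<cdot> \<Delta> h\<close> with \<open>\<xi> \<otimes> \<eta>\<close> gives two of the four terms of the cocycle condition for
  \<open>[f, h]\<close>; the other two come from \<open>h \<cdot> \<Delta> f\<close>.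
\<close>

lemma dual_tensor_action:
  assumes f: "f \<in> finite_dual" and h: "h \<in> finite_dual"
  defines "t \<equiv> tensor_action fscale finite_dual (dual_bracket \<delta>) f (dual_cobracket s br h)"
  shows "t \<in> tensor_space fscale finite_dual"
    and "tensor_form t (\<xi>, \<eta>) =
      dual_bracket \<delta> f (\<lambda>x. h (br \<xi> x)) \<eta> - dual_bracket \<delta> f (\<lambda>x. h (br \<eta> x)) \<xi>"
proof -
  note sub = subsetD[OF finite_dual_subset]
  obtain n :: nat and g l where gl: "\<forall>i<n. g i \<in> finite_dual" "\<forall>i<n. l i \<in> finite_dual"
    and t: "dual_cobracket s br h = (\<Sum>i<n. tensor fscale finite_dual (g i) (l i))"
    and eq: "\<forall>\<xi> \<eta>. h (br \<xi> \<eta>) = (\<Sum>i<n. g i \<xi> * l i \<eta>)"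
    using dual_cobracket_sum[OF h] by blast
  have lin: "linear_on fscale fscale finite_dual (dual_bracket \<delta> f)" "linear_on fscale fscale finite_dual id"
    "dual_bracket \<delta> f ` finite_dual \<subseteq> finite_dual" "id ` finite_dual \<subseteq> finite_dual"
    using linear_on_subset[OF dual_bracket_linear(1)[OF sub[OF f]] finite_dual_subset]
      dual_bracket_finite_dual[OF f]
    by (auto simp: linear_on_def)
  have t_eq: "t = (\<Sum>i<n. tensor fscale finite_dual (dual_bracket \<delta> f (g i)) (l i)) +
      (\<Sum>i<n. tensor fscale finite_dual (g i) (dual_bracket \<delta> f (l i)))"
    unfolding t_def tensor_action_def t
    by (simp add: tensor_map_sum[OF lin(1,2,3,4)] tensor_map_sum[OF lin(2,1,4,3)])
  show "t \<in> tensor_space fscale finite_dual"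
    unfolding t_eq
    by (intro fun_vs.subspace_add[OF subspace_tensor_space] fun_vs.subspace_sum[OF subspace_tensor_space]
        tensor_in_space dual_bracket_finite_dual f) (use gl in auto)
  have "dual_bracket \<delta> f (\<lambda>x. h (br \<xi> x)) \<eta> = (\<Sum>i<n. g i \<xi> * dual_bracket \<delta> f (l i) \<eta>)"
    by (rule dual_bracket_sum_right[OF sub[OF f]]) (use gl sub in \<open>auto simp: eq[rule_format]\<close>)
  moreover have "dual_bracket \<delta> f (\<lambda>x. h (br \<eta> x)) \<xi> = (\<Sum>i<n. - l i \<eta> * dual_bracket \<delta> f (g i) \<xi>)"
  proof (rule dual_bracket_sum_right[OF sub[OF f]])
    fix x
    have "h (br \<eta> x) = - h (br x \<eta>)"
      using dualD(3)[OF sub[OF h], of "br x \<eta>"] br_skew[of \<eta> x] by simp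
    then show "h (br \<eta> x) = (\<Sum>i<n. - l i \<eta> * g i x)" by (simp add: eq[rule_format] sum_negf mult.commute)
  qed (use gl sub in auto)
  ultimately show "tensor_form t (\<xi>, \<eta>) =
      dual_bracket \<delta> f (\<lambda>x. h (br \<xi> x)) \<eta> - dual_bracket \<delta> f (\<lambda>x. h (br \<eta> x)) \<xi>"
    unfolding t_eq tensor_form_add by (simp add: tensor_form_sum sum_negf mult.commute)
qed

lemma dual_lie_bialgebra: "lie_bialgebra_on fscale finite_dual (dual_bracket \<delta>) (dual_cobracket s br)"
  unfolding lie_bialgebra_on_def
proof (intro conjI dual_lie_algebra dual_lie_coalgebra ballI)
  fix f h assume f: "f \<in> finite_dual" and h: "h \<in> finite_dual"
  note sub = subsetD[OF finite_dual_subset]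
  let ?act = "tensor_action fscale finite_dual (dual_bracket \<delta>)"
  let ?t = "?act f (dual_cobracket s br h) - ?act h (dual_cobracket s br f)"
  have "tensor_form ?t (\<xi>, \<eta>) = dual_bracket \<delta> f h (br \<xi> \<eta>)" for \<xi> \<eta>
    by (simp add: tensor_form_diff dual_tensor_action(2) f h dual_bracket_cocycle sub
        dual_bracket_skew[of h])
  then have "tensor_form ?t = bracket_dual br (dual_bracket \<delta> f h)"
    by (auto simp: bracket_dual_def fun_eq_iff)
  moreover have "?t \<in> tensor_space fscale finite_dual"
    by (intro fun_vs.subspace_diff[OF subspace_tensor_space] dual_tensor_action f h)
  ultimately show "dual_cobracket s br (dual_bracket \<delta> f h) = ?t"
    using dual_cobracket_unique[OF dual_bracket_finite_dual[OF f h]] by metis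
qed

lemma is_dual_lie_bialgebra_finite_dual:
  "is_dual_lie_bialgebra s br \<delta> (maximal_good_subspace s br) (dual_bracket \<delta>) (dual_cobracket s br)"
  unfolding is_dual_lie_bialgebra_def maximal_good_subspace_eq
  using dual_lie_bialgebra by (auto simp: dual_bracket_def tensor_form_dual_cobracket)

end

section \<open>The Heisenberg-Virasoro algebra as a Lie bialgebra\<close>

lemma laurent_scale_conv_mult: "laurent_scale c f = Poly_Mapping.single 0 c * f"
  by (simp add: laurent_scale_def mult_map_scale_conv_mult)

lemma laurent_expansion: "f = (\<Sum>n\<in>Poly_Mapping.keys f. laurent_scale (Poly_Mapping.lookup f n) (lmonom n))"
proof (rule poly_mapping_eqI)
  fix m
  have "(\<Sum>n\<in>Poly_Mapping.keys f. Poly_Mapping.lookup f n * (1 when n = m)) = Poly_Mapping.lookup f m"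
    by (simp add: when_def sum.delta' if_distrib[of "(*) _"] in_keys_iff cong: if_cong)
  then show "Poly_Mapping.lookup f m =
      Poly_Mapping.lookup (\<Sum>n\<in>Poly_Mapping.keys f. laurent_scale (Poly_Mapping.lookup f n) (lmonom n)) m"
    by (simp add: lookup_sum lookup_laurent_scale lookup_single)
qed

lemma laurent_induct [case_names zero add single]:
  assumes "P 0" "\<And>f g. P f \<Longrightarrow> P g \<Longrightarrow> P (f + g)" "\<And>n c. P (Poly_Mapping.single n c)"
  shows "P (f :: 'k::field laurent)"
proof -
  have "P (\<Sum>n\<in>K. laurent_scale (Poly_Mapping.lookup f n) (lmonom n))" for K
    by (induction K rule: infinite_finite_induct) (auto simp: assms laurent_scale_single)
  then show ?thesis using laurent_expansion[of f] by metis
qed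

lemma laurent_deriv_add: "laurent_deriv (f + g) = laurent_deriv f + laurent_deriv g"
  by (auto intro!: poly_mapping_eqI simp: laurent_deriv.rep_eq lookup_add algebra_simps)

lemma laurent_deriv_diff: "laurent_deriv (f - g) = laurent_deriv f - laurent_deriv g"
  by (simp add: eq_diff_eq flip: laurent_deriv_add)

lemma laurent_deriv_mult: "laurent_deriv (f * g) = laurent_deriv f * g + f * laurent_deriv g"
proof (induction f rule: laurent_induct)
  case (single m c)
  show ?case
  proof (induction g rule: laurent_induct)
    case (single n d)
    show ?case
      by (simp add: mult_single laurent_deriv_single algebra_simps flip: single_add)
  qed (simp_all add: laurent_deriv_0 laurent_deriv_add algebra_simps)
qed (simp_all add: laurent_deriv_0 laurent_deriv_add algebra_simps)

lemma laurent_deriv_1: "laurent_deriv 1 = 0"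
  using laurent_deriv_single[of 0 1] by simp

lemma hv_bracket_eq: "hv_bracket \<xi> \<eta> =
    (fst \<xi> * laurent_deriv (fst \<eta>) - fst \<eta> * laurent_deriv (fst \<xi>),
     fst \<xi> * laurent_deriv (snd \<eta>) - fst \<eta> * laurent_deriv (snd \<xi>))"
  by (cases \<xi>; cases \<eta>) simp

lemma hv_lie_algebra_on: "lie_algebra_on hv_scale UNIV hv_bracket"
  unfolding lie_algebra_on_def
proof (intro conjI ballI)
  interpret H: vector_space hv_scale by (rule vector_space_hv_scale)
  show "H.subspace UNIV" by (rule H.subspace_UNIV)
  fix x y z :: "'a hv"
  show "linear_on hv_scale hv_scale UNIV (hv_bracket x)"
    "linear_on hv_scale hv_scale UNIV (\<lambda>x. hv_bracket x y)"
    by (simp_all add: linear_on_def hv_bracket_eq hv_scale_def laurent_deriv_add laurent_deriv_mult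
        laurent_deriv_single laurent_scale_conv_mult algebra_simps)
  show "hv_bracket x (hv_bracket y z) + hv_bracket y (hv_bracket z x) + hv_bracket z (hv_bracket x y) = 0"
    by (simp add: hv_bracket_eq laurent_deriv_diff laurent_deriv_mult zero_prod_def algebra_simps)
qed (auto simp: vector_space_hv_scale hv_bracket_eq zero_prod_def)

interpretation hv: lie_algebra hv_scale hv_bracket
  by unfold_locales (rule hv_lie_algebra_on)

text \<open>
  The part of the cobracket that depends on \<open>\<xi>\<close>: the derivation \<open>L\<^sub>n \<mapsto> (n \<alpha> + \<gamma>) I\<^sub>n\<close>,
  \<open>I\<^sub>n \<mapsto> \<beta> I\<^sub>n\<close>. The cobracket is then \<open>\<xi> \<mapsto> I\<^sub>0 \<otimes> D \<xi> - D \<xi> \<otimes> I\<^sub>0\<close>, where \<open>I\<^sub>0\<close> is central.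
  On the first component, \<open>x\<^bsup>n+1\<^esup> \<mapsto> (n \<alpha> + \<gamma>) x\<^sup>n\<close> is \<open>\<alpha> d/dx\<close> plus multiplication by \<open>(\<gamma> - \<alpha>) x\<^bsup>-1\<^esup>\<close>.
\<close>

definition hv_derivation :: "'k \<Rightarrow> 'k \<Rightarrow> 'k \<Rightarrow> 'k::field hv \<Rightarrow> 'k hv" where
  "hv_derivation \<alpha> \<beta> \<gamma> \<xi> = (0, laurent_scale \<alpha> (laurent_deriv (fst \<xi>)) +
     laurent_scale (\<gamma> - \<alpha>) (lmonom (- 1) * fst \<xi>) + laurent_scale \<beta> (snd \<xi>))"

lemma hv_derivation_linear:
  "hv_derivation \<alpha> \<beta> \<gamma> (x + y) = hv_derivation \<alpha> \<beta> \<gamma> x + hv_derivation \<alpha> \<beta> \<gamma> y"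
  "hv_derivation \<alpha> \<beta> \<gamma> (hv_scale c x) = hv_scale c (hv_derivation \<alpha> \<beta> \<gamma> x)"
  by (simp_all add: hv_derivation_def hv_scale_def laurent_deriv_add laurent_deriv_mult
      laurent_deriv_single laurent_scale_conv_mult algebra_simps)

lemma hv_derivation_L: "hv_derivation \<alpha> \<beta> \<gamma> (hv_L n) = hv_scale (of_int n * \<alpha> + \<gamma>) (hv_I n)"
  by (simp add: hv_derivation_def hv_L_def hv_I_def hv_scale_def laurent_deriv_single mult_single
      laurent_scale_single laurent_scale_0 algebra_simps flip: single_add)

lemma hv_derivation_I: "hv_derivation \<alpha> \<beta> \<gamma> (hv_I n) = hv_scale \<beta> (hv_I n)"
  by (simp add: hv_derivation_def hv_I_def hv_scale_def laurent_deriv_0 laurent_scale_0 laurent_scale_single)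

lemma hv_derivation_bracket:
  "hv_derivation \<alpha> \<beta> \<gamma> (hv_bracket \<xi> \<eta>) =
    hv_bracket \<xi> (hv_derivation \<alpha> \<beta> \<gamma> \<eta>) - hv_bracket \<eta> (hv_derivation \<alpha> \<beta> \<gamma> \<xi>)"
  by (simp add: hv_derivation_def hv_bracket_eq laurent_deriv_add laurent_deriv_diff laurent_deriv_mult
      laurent_deriv_single laurent_deriv_0 laurent_scale_conv_mult algebra_simps)

lemma hv_I_0_central: "hv_bracket \<xi> (hv_I 0) = 0"
  by (simp add: hv_bracket_eq hv_I_def laurent_deriv_1 laurent_deriv_0 zero_prod_def)

text \<open>The finite set of monomials \<open>hv_monom a\<close> at which the coordinate \<open>hv_eps a \<xi>\<close> is nonzero.\<close>

definition hv_support :: "'k::field hv \<Rightarrow> (int + int) set" where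
  "hv_support \<xi> = {a. hv_eps a \<xi> \<noteq> 0}"

lemma hv_eps_simps [simp]:
  "hv_eps (Inl i) \<xi> = Poly_Mapping.lookup (fst \<xi>) i"
  "hv_eps (Inr i) \<xi> = Poly_Mapping.lookup (snd \<xi>) i"
  by (simp_all add: hv_eps_def functional_pair_def eps_def)

lemma hv_support_eq: "hv_support \<xi> = Inl ` Poly_Mapping.keys (fst \<xi>) \<union> Inr ` Poly_Mapping.keys (snd \<xi>)"
proof (rule set_eqI)
  show "a \<in> hv_support \<xi> \<longleftrightarrow> a \<in> Inl ` Poly_Mapping.keys (fst \<xi>) \<union> Inr ` Poly_Mapping.keys (snd \<xi>)" for a
    by (cases a) (auto simp: hv_support_def in_keys_iff)
qed

lemma finite_hv_support [simp]: "finite (hv_support \<xi>)"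
  by (simp add: hv_support_eq)

lemma hv_expansion: "\<xi> = (\<Sum>a\<in>hv_support \<xi>. hv_scale (hv_eps a \<xi>) (hv_monom a))"
proof -
  have "(\<Sum>a\<in>hv_support \<xi>. hv_scale (hv_eps a \<xi>) (hv_monom a)) =
      (\<Sum>n\<in>Poly_Mapping.keys (fst \<xi>). (laurent_scale (Poly_Mapping.lookup (fst \<xi>) n) (lmonom n), 0)) +
      (\<Sum>n\<in>Poly_Mapping.keys (snd \<xi>). (0, laurent_scale (Poly_Mapping.lookup (snd \<xi>) n) (lmonom n)))"
    unfolding hv_support_eq
    by (subst sum.union_disjoint) (auto simp: sum.reindex hv_monom_def hv_scale_def laurent_scale_0)
  also have "\<dots> = (fst \<xi>, snd \<xi>)"
    using laurent_expansion[of "fst \<xi>"] laurent_expansion[of "snd \<xi>"]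
    by (simp add: prod_eq_iff fst_sum snd_sum)
  finally show ?thesis by simp
qed

lemma hv_dual_expansion:
  assumes "f \<in> hv_dual"
  shows "f \<xi> = (\<Sum>a\<in>hv_support \<xi>. hv_eps a \<xi> * f (hv_monom a))"
proof -
  interpret f: Vector_Spaces.linear hv_scale "(*)" f using assms by (simp add: dual_space_def)
  have "f (\<Sum>a\<in>hv_support \<xi>. hv_scale (hv_eps a \<xi>) (hv_monom a)) =
      (\<Sum>a\<in>hv_support \<xi>. hv_eps a \<xi> * f (hv_monom a))"
    by (simp add: f.sum f.scale)
  then show ?thesis using hv_expansion[of \<xi>] by simp
qed

lemma hv_monom_Inl: "hv_monom (Inl i) = hv_L (i - 1)" and hv_monom_Inr: "hv_monom (Inr i) = hv_I i"
  by (simp_all add: hv_monom_def hv_L_def hv_I_def)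

lemma hv_linear_eqI:
  assumes "Vector_Spaces.linear hv_scale fscale F" "Vector_Spaces.linear hv_scale fscale G"
    and "\<And>n. F (hv_L n) = G (hv_L n)" "\<And>n. F (hv_I n) = G (hv_I n)"
  shows "F = G"
proof
  interpret F: Vector_Spaces.linear hv_scale fscale F by fact
  interpret G: Vector_Spaces.linear hv_scale fscale G by fact
  fix \<xi>
  have "F (hv_monom a) = G (hv_monom a)" for a
    using assms(3,4) by (cases a) (simp_all add: hv_monom_Inl hv_monom_Inr)
  then have "F (\<Sum>a\<in>hv_support \<xi>. hv_scale (hv_eps a \<xi>) (hv_monom a)) =
      G (\<Sum>a\<in>hv_support \<xi>. hv_scale (hv_eps a \<xi>) (hv_monom a))"
    by (simp add: F.sum G.sum F.scale G.scale)
  then show "F \<xi> = G \<xi>" using hv_expansion[of \<xi>] by simp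
qed

lemma hv_cobracket_eq:
  assumes "Vector_Spaces.linear hv_scale fscale \<delta>"
    and "\<And>n. \<delta> (hv_L n) =
      fscale (of_int n * \<alpha> + \<gamma>) (hv_tensor (hv_I 0) (hv_I n) - hv_tensor (hv_I n) (hv_I 0))"
    and "\<And>n. \<delta> (hv_I n) =
      fscale \<beta> (hv_tensor (hv_I 0) (hv_I n) - hv_tensor (hv_I n) (hv_I 0))"
  shows "\<delta> \<xi> = hv_tensor (hv_I 0) (hv_derivation \<alpha> \<beta> \<gamma> \<xi>) - hv_tensor (hv_derivation \<alpha> \<beta> \<gamma> \<xi>) (hv_I 0)"
proof -
  interpret H: vector_space hv_scale by (rule vector_space_hv_scale)
  have "\<delta> = (\<lambda>\<xi>. hv_tensor (hv_I 0) (hv_derivation \<alpha> \<beta> \<gamma> \<xi>) - hv_tensor (hv_derivation \<alpha> \<beta> \<gamma> \<xi>) (hv_I 0))"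
  proof (rule hv_linear_eqI[OF assms(1)])
    show "Vector_Spaces.linear hv_scale fscale
        (\<lambda>\<xi>. hv_tensor (hv_I 0) (hv_derivation \<alpha> \<beta> \<gamma> \<xi>) - hv_tensor (hv_derivation \<alpha> \<beta> \<gamma> \<xi>) (hv_I 0))"
      by unfold_locales
        (simp_all add: hv_derivation_linear tensor_bilinear fun_vs.scale_right_diff_distrib)
  qed (simp_all add: assms hv_derivation_L hv_derivation_I tensor_bilinear
      fun_vs.scale_right_diff_distrib)
  then show ?thesis by (rule fun_cong)
qed

lemma hv_lie_bialgebra_on:
  fixes \<delta> :: "'k::field hv \<Rightarrow> ('k, 'k hv) tensor2"
  assumes lin: "Vector_Spaces.linear hv_scale fscale \<delta>"
    and \<delta>: "\<And>\<xi>. \<delta> \<xi> = hv_tensor (hv_I 0) (hv_derivation \<alpha> \<beta> \<gamma> \<xi>) - hv_tensor (hv_derivation \<alpha> \<beta> \<gamma> \<xi>) (hv_I 0)"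
  shows "lie_bialgebra_on hv_scale UNIV hv_bracket \<delta>"
proof -
  interpret H: vector_space hv_scale by (rule vector_space_hv_scale)
  interpret \<delta>: Vector_Spaces.linear hv_scale fscale \<delta> by (rule lin)
  define D where "D = hv_derivation \<alpha> \<beta> \<gamma>"
  have \<delta>': "\<delta> \<xi> B = (if bilinear_form_on hv_scale UNIV B then B (hv_I 0, D \<xi>) - B (D \<xi>, hv_I 0) else 0)" for \<xi> B
    by (simp add: \<delta> D_def tensor_def)
  have B0: "B (0, x) = 0" "B (x, 0) = 0" if "bilinear_form_on hv_scale UNIV B"
    for B :: "'k hv \<times> 'k hv \<Rightarrow> 'k" and x
  proof -
    have "linear_on hv_scale (*) UNIV (\<lambda>y. B (y, x))" "linear_on hv_scale (*) UNIV (\<lambda>y. B (x, y))"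
      using that unfolding bilinear_form_on_def by blast+
    from this[THEN linear_form_0[OF vector_space_hv_scale H.subspace_UNIV]]
    show "B (0, x) = 0" "B (x, 0) = 0" .
  qed
  have Bd: "B (x - y, z) = B (x, z) - B (y, z)" "B (z, x - y) = B (z, x) - B (z, y)"
    if "bilinear_form_on hv_scale UNIV B" for B :: "'k hv \<times> 'k hv \<Rightarrow> 'k" and x y z
  proof -
    have "B (x - y + y, z) = B (x - y, z) + B (y, z)" "B (z, x - y + y) = B (z, x - y) + B (z, y)"
      using that unfolding bilinear_form_on_def linear_on_def by blast+
    then show "B (x - y, z) = B (x, z) - B (y, z)" "B (z, x - y) = B (z, x) - B (z, y)" by auto
  qed
  have coalg: "lie_coalgebra_on hv_scale UNIV \<delta>"
    unfolding lie_coalgebra_on_def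
  proof (intro conjI ballI)
    show "vector_space (hv_scale :: 'k \<Rightarrow> _)" by (rule vector_space_hv_scale)
    show "H.subspace UNIV" by (rule H.subspace_UNIV)
    show "linear_on hv_scale fscale UNIV \<delta>"
      by (simp add: linear_on_def \<delta>.add \<delta>.scale)
    fix \<xi>
    show "\<delta> \<xi> \<in> tensor_space hv_scale UNIV"
      unfolding \<delta> by (intro fun_vs.subspace_diff[OF subspace_tensor_space] tensor_in_space) auto
    show "tensor_flip (\<delta> \<xi>) = - \<delta> \<xi>"
      by (auto simp: tensor_flip_def \<delta>' bilinear_form_on_flip)
    have t: "id_tensor_cobracket hv_scale UNIV \<delta> (\<delta> \<xi>) T =
        (if trilinear_form_on hv_scale UNIV T
         then T (hv_I 0, hv_I 0, D (D \<xi>)) - T (hv_I 0, D (D \<xi>), hv_I 0) else 0)" for T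
    proof (cases "trilinear_form_on hv_scale UNIV T")
      case True
      have "\<delta> x \<in> tensor_space hv_scale UNIV" for x
        unfolding \<delta> by (intro fun_vs.subspace_diff[OF subspace_tensor_space] tensor_in_space) auto
      then have bil: "bilinear_form_on hv_scale UNIV (\<lambda>(x, y). \<delta> y (\<lambda>(u, v). T (x, u, v)))"
        by (intro bilinear_id_tensor_cobracket[OF vector_space_hv_scale H.subspace_UNIV _ _ True])
          (simp_all add: linear_on_def \<delta>.add \<delta>.scale)
      have b: "bilinear_form_on hv_scale UNIV (\<lambda>(u, v). T (x, u, v))" for x
        by (rule trilinear_form_onD(1)[OF True]) simp
      have "D (hv_I 0) = hv_scale \<beta> (hv_I 0)" by (simp add: D_def hv_derivation_I)
      moreover have "T (x, hv_scale \<beta> (hv_I 0), hv_I 0) = \<beta> * T (x, hv_I 0, hv_I 0)"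
        "T (x, hv_I 0, hv_scale \<beta> (hv_I 0)) = \<beta> * T (x, hv_I 0, hv_I 0)" for x
        using True unfolding trilinear_form_on_def linear_on_def by blast+
      ultimately show ?thesis
        using True bil b by (simp add: id_tensor_cobracket_def \<delta>')
    next
      case False
      then show ?thesis by (simp add: id_tensor_cobracket_def)
    qed
    show "let t = id_tensor_cobracket hv_scale UNIV \<delta> (\<delta> \<xi>)
      in t + tensor_cycle t + tensor_cycle (tensor_cycle t) = 0"
      unfolding Let_def
    proof
      fix T :: "'k hv \<times> 'k hv \<times> 'k hv \<Rightarrow> 'k"
      have "trilinear_form_on hv_scale UNIV (\<lambda>(x, y, z). T (z, x, y)) \<longleftrightarrow> trilinear_form_on hv_scale UNIV T"
        by (auto simp: trilinear_form_on_def)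
      then show "(id_tensor_cobracket hv_scale UNIV \<delta> (\<delta> \<xi>) +
          tensor_cycle (id_tensor_cobracket hv_scale UNIV \<delta> (\<delta> \<xi>)) +
          tensor_cycle (tensor_cycle (id_tensor_cobracket hv_scale UNIV \<delta> (\<delta> \<xi>)))) T = 0 T"
        using trilinear_form_on_cycle[of hv_scale UNIV T]
        by (simp add: tensor_cycle_def t case_prod_unfold)
    qed
  qed
  have "\<delta> (hv_bracket x y) = tensor_action hv_scale UNIV hv_bracket x (\<delta> y)
      - tensor_action hv_scale UNIV hv_bracket y (\<delta> x)" for x y
  proof
    fix B :: "'k hv \<times> 'k hv \<Rightarrow> 'k"
    have bil: "bilinear_form_on hv_scale UNIV (\<lambda>(u, v). B (hv_bracket x u, v))"
      "bilinear_form_on hv_scale UNIV (\<lambda>(u, v). B (u, hv_bracket x v))"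
      if "bilinear_form_on hv_scale UNIV B" for x
    proof -
      have "linear_on hv_scale hv_scale UNIV (hv_bracket x)"
        using hv_lie_algebra_on by (simp only: lie_algebra_on_def) blast
      moreover have "linear_on hv_scale hv_scale UNIV (id :: 'k hv \<Rightarrow> 'k hv)"
        by (simp add: linear_on_def)
      ultimately show "bilinear_form_on hv_scale UNIV (\<lambda>(u, v). B (hv_bracket x u, v))"
        "bilinear_form_on hv_scale UNIV (\<lambda>(u, v). B (u, hv_bracket x v))"
        using bilinear_form_on_compose[OF that, of "hv_bracket x" id]
          bilinear_form_on_compose[OF that, of id "hv_bracket x"] by (simp_all only: id_apply subset_UNIV)
    qed
    show "\<delta> (hv_bracket x y) B = (tensor_action hv_scale UNIV hv_bracket x (\<delta> y)
        - tensor_action hv_scale UNIV hv_bracket y (\<delta> x)) B"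
      using bil
      by (simp add: tensor_action_def tensor_map_def \<delta>' hv_I_0_central B0 Bd D_def hv_derivation_bracket)
  qed
  with coalg show ?thesis by (simp add: lie_bialgebra_on_def hv_lie_algebra_on)
qed

section \<open>Linearly recursive sequences\<close>

lemma span_image_sum:
  assumes "x \<in> fun_vs.span (R ` {..<A::nat})"
  shows "\<exists>c. x = (\<Sum>a<A. fscale (c a) (R a))"
  using assms
proof (induction rule: fun_vs.span_induct_alt)
  case base
  show ?case by (intro exI[of _ "\<lambda>_. 0"]) simp
next
  case (step d x y)
  then obtain b c where b: "b < A" "x = R b" and y: "y = (\<Sum>a<A. fscale (c a) (R a))" by auto
  have "(\<Sum>a<A. fscale (c a + (if a = b then d else 0)) (R a)) =
      (\<Sum>a<A. fscale (c a) (R a)) + (\<Sum>a<A. if a = b then fscale d (R a) else 0)"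
    by (subst sum.distrib[symmetric]) (auto intro!: sum.cong simp: fun_vs.scale_left_distrib)
  also have "\<dots> = fscale d x + y" using b by (simp add: y add.commute)
  finally show ?case by metis
qed

text \<open>
  A two-sided sequence is linearly recursive iff its Hankel matrix has finite rank. Here the translates of a
  recursive sequence span a space of dimension at most the order of the recursion, since the recursion
  can be run in both directions once its last coefficient is nonzero.
\<close>

lemma recursive_imp_hankel_finite_rank:
  fixes F :: "int \<Rightarrow> 'k::field"
  assumes "\<exists>(r::nat) c. \<forall>n. F n = (\<Sum>j = 1..r. c j * F (n - int j))"
  shows "finite_rank (\<lambda>(i, j). F (i + j))"
proof -
  define rec where "rec r \<longleftrightarrow> (\<exists>c. \<forall>n. F n = (\<Sum>j = 1..r. c j * F (n - int j)))" for r :: nat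
  define r where "r = (LEAST r. rec r)"
  have "rec r" unfolding r_def by (rule LeastI_ex) (use assms in \<open>simp add: rec_def\<close>)
  then obtain c where c: "\<forall>n. F n = (\<Sum>j = 1..r. c j * F (n - int j))" by (auto simp: rec_def)
  define R where "R i = (\<lambda>j. F (i + j))" for i
  define S where "S = fun_vs.span ((\<lambda>k. R (int k)) ` {..<r})"
  have S: "fun_vs.subspace S" unfolding S_def by (rule fun_vs.subspace_span)
  have "R i \<in> S" for i
  proof (cases "r = 0")
    case True
    then have "R i = 0" using c by (auto simp: R_def)
    then show ?thesis using fun_vs.subspace_0[OF S] by simp
  next
    case False
    then obtain q where q: "r = Suc q" by (cases r) auto
    \<comment> \<open>\<open>r\<close> is the least order of a recursion, so its last coefficient does not vanish\<close>
    have cr: "c r \<noteq> 0"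
    proof
      assume "c r = 0"
      then have "F n = (\<Sum>j = 1..q. c j * F (n - int j))" for n
        using c[rule_format, of n] by (simp add: q)
      then have "rec q" unfolding rec_def by blast
      then show False using Least_le[of rec q] by (simp add: r_def[symmetric] q)
    qed
    have Rrec: "R i = (\<Sum>j = 1..r. fscale (c j) (R (i - int j)))" for i
    proof
      fix j
      have "F (i + j) = (\<Sum>k = 1..r. c k * F (i + j - int k))" using c by blast
      then show "R i j = (\<Sum>j = 1..r. fscale (c j) (R (i - int j))) j"
        by (simp add: R_def sum_fun_apply fscale_def algebra_simps)
    qed
    \<comment> \<open>a window of \<open>r\<close> consecutive translates moves one step up by the recursion, and one step down by
      solving the recursion for its last term\<close>
    have "\<forall>k<r. R (i + int k) \<in> S" for i
    proof (induction i rule: int_induct[where k = 0])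
      case base
      show ?case unfolding S_def by (auto intro: fun_vs.span_base)
    next
      case (step1 i)
      have "R (i + int r) \<in> S"
        unfolding Rrec[of "i + int r"]
      proof (intro fun_vs.subspace_sum[OF S] fun_vs.subspace_scale[OF S])
        fix j assume "j \<in> {1..r}"
        then have "i + int r - int j = i + int (r - j)" "r - j < r" by auto
        then show "R (i + int r - int j) \<in> S" using step1(2) by metis
      qed
      show ?case
      proof (intro allI impI)
        fix k assume k: "k < r"
        have "R (i + int (Suc k)) \<in> S"
        proof (cases "Suc k = r")
          case False
          then have "Suc k < r" using k by simp
          with step1(2) show ?thesis by blast
        qed (use \<open>R (i + int r) \<in> S\<close> in blast)
        then show "R (i + 1 + int k) \<in> S" by (simp add: add_ac)
      qed
    next
      case (step2 i)
      have "R (i - 1 + int r) = fscale (c r) (R (i - 1)) + (\<Sum>j = 1..q. fscale (c j) (R (i - 1 + int r - int j)))"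
        using Rrec[of "i - 1 + int r"] by (simp add: q add.commute)
      then have "R (i - 1) =
          fscale (1 / c r) (R (i - 1 + int r) - (\<Sum>j = 1..q. fscale (c j) (R (i - 1 + int r - int j))))"
        using cr by (auto simp: fun_eq_iff fscale_def)
      moreover have "R (i - 1 + int r - int j) \<in> S" if "j \<in> {0..q}" for j
      proof -
        have "i - 1 + int r - int j = i + int (q - j)" "q - j < r" using that q by auto
        then show ?thesis using step2(2) by metis
      qed
      then have "R (i - 1 + int r) - (\<Sum>j = 1..q. fscale (c j) (R (i - 1 + int r - int j))) \<in> S"
        by (intro fun_vs.subspace_diff[OF S] fun_vs.subspace_sum[OF S] fun_vs.subspace_scale[OF S])
          (use \<open>\<And>j. j \<in> {0..q} \<Longrightarrow> R (i - 1 + int r - int j) \<in> S\<close>[of 0] in auto)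
      ultimately have "R (i - 1) \<in> S" using fun_vs.subspace_scale[OF S] by simp
      show ?case
      proof (intro allI impI)
        fix k assume k: "k < r"
        show "R (i - 1 + int k) \<in> S"
          using \<open>R (i - 1) \<in> S\<close> step2(2) k
          by (cases k) (auto simp: add_ac)
      qed
    qed
    from this[of i] q show ?thesis by auto
  qed
  then have "\<forall>i. \<exists>g. R i = (\<Sum>k<r. fscale (g k) (R (int k)))"
    unfolding S_def using span_image_sum by blast
  then obtain g where g: "\<forall>i. R i = (\<Sum>k<r. fscale (g i k) (R (int k)))" by metis
  have Fg: "F (i + j) = (\<Sum>k<r. g i k * F (int k + j))" for i j
    using fun_cong[OF g[rule_format, of i], of j] by (simp add: R_def sum_fun_apply fscale_def)
  show ?thesis
    by (rule finite_rankI[of _ "\<lambda>k i. g i k" "\<lambda>k j. F (int k + j)" "{..<r}"], unfold prod.case, rule Fg)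
qed

text \<open>
  Conversely, if the translates span a finite-dimensional space, then some translate depends on
  finitely many preceding ones, and this relation is a recursion.
\<close>

lemma hankel_finite_rank_imp_recursive:
  fixes F :: "int \<Rightarrow> 'k::field"
  assumes "finite_rank (\<lambda>(i, j). F (i + j))"
  shows "\<exists>(r::nat) c. \<forall>n. F n = (\<Sum>j = 1..r. c j * F (n - int j))"
proof -
  obtain m :: nat and g h where gh: "\<forall>i j. F (i + j) = (\<Sum>k<m. g k i * h k j)"
    using finite_rank_sum[OF assms] by auto
  define R where "R a = (\<lambda>j. F (int a + j))" for a :: nat
  have span: "R a \<in> fun_vs.span (h ` {..<m})" for a
  proof -
    have "R a = (\<Sum>k<m. fscale (g k (int a)) (h k))"
      by (auto simp: R_def gh fscale_def sum_fun_apply)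
    then show ?thesis by (auto intro!: fun_vs.span_sum fun_vs.span_scale intro: fun_vs.span_base)
  qed
  have "\<exists>A. R A \<in> fun_vs.span (R ` {..<A})"
  proof (rule ccontr)
    assume "\<nexists>A. R A \<in> fun_vs.span (R ` {..<A})"
    then have "\<not> fun_vs.dependent (R ` {..<A}) \<and> card (R ` {..<A}) = A" for A
    proof (induction A)
      case (Suc A)
      then have "R A \<notin> fun_vs.span (R ` {..<A})" by blast
      moreover from this have "R A \<notin> R ` {..<A}"
        using fun_vs.span_superset[of "R ` {..<A}"] by blast
      moreover have "R ` {..<Suc A} = insert (R A) (R ` {..<A})" by (simp add: lessThan_Suc)
      ultimately show ?case
        using Suc.IH[OF Suc.prems] by (simp only: fun_vs.independent_insert) simp
    qed (simp add: fun_vs.independent_empty)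
    from this[of "Suc m"] fun_vs.independent_span_bound[of "h ` {..<m}" "R ` {..<Suc m}"] span
    have "Suc m \<le> card (h ` {..<m})" by auto
    with card_image_le[of "{..<m}" h] show False by simp
  qed
  then obtain A c where A: "R A = (\<Sum>a<A. fscale (c a) (R a))" using span_image_sum by blast
  have "F n = (\<Sum>j = 1..A. c (A - j) * F (n - int j))" for n
  proof -
    have "F n = R A (n - int A)" by (simp add: R_def)
    also have "\<dots> = (\<Sum>a<A. c a * F (int a + (n - int A)))"
      by (simp add: A sum_fun_apply fscale_def) (simp add: R_def)
    also have "\<dots> = (\<Sum>j = 1..A. c (A - j) * F (n - int j))"
      by (rule sum.reindex_bij_witness[of _ "\<lambda>j. A - j" "\<lambda>a. A - a"])
        (auto simp: of_nat_diff algebra_simps)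
    finally show ?thesis .
  qed
  then show ?thesis by (intro exI[of _ A] exI[of _ "\<lambda>j. c (A - j)"]) blast
qed

section \<open>The maximal good subspace\<close>

lemma functional_pair_dual:
  assumes "f \<in> dual_space laurent_scale" "g \<in> dual_space laurent_scale"
  shows "functional_pair f g \<in> hv_dual"
proof -
  interpret f: Vector_Spaces.linear laurent_scale "(*)" f using assms by (simp add: dual_space_def)
  interpret g: Vector_Spaces.linear laurent_scale "(*)" g using assms by (simp add: dual_space_def)
  show ?thesis
    unfolding hv.dual_space_iff
    by (simp add: linear_on_def functional_pair_def hv_scale_def f.add g.add f.scale g.scale algebra_simps)
qed

lemma hv_dual_components:
  assumes "f \<in> hv_dual"
  shows "(\<lambda>p. f (p, 0)) \<in> dual_space laurent_scale" "(\<lambda>q. f (0, q)) \<in> dual_space laurent_scale"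
    "f = functional_pair (\<lambda>p. f (p, 0)) (\<lambda>q. f (0, q))"
proof -
  interpret L: vector_space laurent_scale by (rule vector_space_laurent_scale)
  have f: "f (x + y) = f x + f y" "f (hv_scale c x) = c * f x" for x y c
    using assms by (simp_all add: hv.dualD)
  show "(\<lambda>p. f (p, 0)) \<in> dual_space laurent_scale"
    unfolding dual_space_def
    using f(1)[of "(_, 0)" "(_, 0)"] f(2)[of _ "(_, 0)"] vector_space_mult vector_space_laurent_scale
    by (auto intro!: Vector_Spaces.linear.intro module_hom.intro module_hom_axioms.intro
        simp: hv_scale_def laurent_scale_0 module_iff_vector_space)
  show "(\<lambda>q. f (0, q)) \<in> dual_space laurent_scale"
    unfolding dual_space_def
    using f(1)[of "(0, _)" "(0, _)"] f(2)[of _ "(0, _)"] vector_space_mult vector_space_laurent_scale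
    by (auto intro!: Vector_Spaces.linear.intro module_hom.intro module_hom_axioms.intro
        simp: hv_scale_def laurent_scale_0 module_iff_vector_space)
  show "f = functional_pair (\<lambda>p. f (p, 0)) (\<lambda>q. f (0, q))"
  proof
    fix \<xi>
    have "f \<xi> = f (fst \<xi>, 0) + f (0, snd \<xi>)" using f(1)[of "(fst \<xi>, 0)" "(0, snd \<xi>)"] by simp
    then show "f \<xi> = functional_pair (\<lambda>p. f (p, 0)) (\<lambda>q. f (0, q)) \<xi>"
      unfolding functional_pair_def .
  qed
qed

text \<open>The bracket in the basis of monomials.\<close>

lemma hv_bracket_monom:
  "hv_bracket (hv_monom (Inl i)) (hv_monom (Inl j)) = hv_scale (of_int (j - i)) (hv_monom (Inl (i + j - 1)))"
  "hv_bracket (hv_monom (Inl i)) (hv_monom (Inr j)) = hv_scale (of_int j) (hv_monom (Inr (i + j - 1)))"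
  "hv_bracket (hv_monom (Inr i)) (hv_monom (Inl j)) = hv_scale (- of_int i) (hv_monom (Inr (i + j - 1)))"
  "hv_bracket (hv_monom (Inr i)) (hv_monom (Inr j)) = 0"
  by (simp_all add: hv_monom_def hv_scale_def laurent_deriv_single laurent_deriv_0 laurent_scale_0
      laurent_scale_single mult_single zero_prod_def algebra_simps flip: single_diff single_uminus)

text \<open>
  For the first component \<open>f\<close> of a functional, the matrix of its image under the dual of the bracket in the
  monomials of the first kind is \<open>M i j = (j - i) f(x\<^bsup>i+j-1\<^esup>)\<close>, and
  \<open>M (i + 1) j - M i (j + 1) = - 2 f(x\<^bsup>i+j\<^esup>)\<close> recovers the Hankel matrix; for the second
  component \<open>g\<close> of the functional, the mixed entries \<open>M i j = j g(x\<^bsup>i+j-1\<^esup>)\<close> satisfy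
  \<open>M i (j + 1) - M (i + 1) j = g(x\<^bsup>i+j\<^esup>)\<close>.
\<close>

lemma hankel_finite_rank_of_finite_dual:
  fixes f :: "'k::field_char_0 hv \<Rightarrow> 'k"
  assumes "f \<in> hv.finite_dual"
  shows "finite_rank (\<lambda>(i, j). f (lmonom (i + j), 0))" "finite_rank (\<lambda>(i, j). f (0, lmonom (i + j)))"
proof -
  from assms have f: "f \<in> hv_dual" and rank: "finite_rank (bracket_dual hv_bracket f)"
    by (auto simp: hv.finite_dual_def)
  have rank': "finite_rank (\<lambda>(i, j). f (hv_bracket (hv_monom (u i)) (hv_monom (v j))))" for u v :: "int \<Rightarrow> int + int"
    using finite_rank_comp[OF rank, of "\<lambda>_. 1" "\<lambda>_. 1" "\<lambda>i. hv_monom (u i)" "\<lambda>j. hv_monom (v j)"]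
    by (simp add: bracket_dual_def)
  have "(\<lambda>(i, j). f (lmonom (i + j), 0)) = fscale (- 1 / 2)
      ((\<lambda>(i, j). f (hv_bracket (hv_monom (Inl (i + 1))) (hv_monom (Inl j)))) -
       (\<lambda>(i, j). f (hv_bracket (hv_monom (Inl i)) (hv_monom (Inl (j + 1))))))"
    by (simp add: fun_eq_iff fscale_def hv_bracket_monom hv.dualD[OF f])
      (simp add: hv_monom_def algebra_simps)
  then show "finite_rank (\<lambda>(i, j). f (lmonom (i + j), 0))"
    by (simp only:) (intro finite_rank_scale finite_rank_diff rank')
  have "(\<lambda>(i, j). f (0, lmonom (i + j))) =
      (\<lambda>(i, j). f (hv_bracket (hv_monom (Inl i)) (hv_monom (Inr (j + 1))))) -
      (\<lambda>(i, j). f (hv_bracket (hv_monom (Inl (i + 1))) (hv_monom (Inr j))))"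
    by (simp add: fun_eq_iff fscale_def hv_bracket_monom hv.dualD[OF f])
      (simp add: hv_monom_def algebra_simps)
  then show "finite_rank (\<lambda>(i, j). f (0, lmonom (i + j)))"
    using finite_rank_diff[OF rank' rank'] by simp
qed

text \<open>
  Conversely these matrices arise from Hankel matrices by multiplying rows and columns with scalars,
  and a factorization over the monomials extends linearly.
\<close>

lemma finite_dual_of_hankel_finite_rank:
  fixes f :: "'k::field hv \<Rightarrow> 'k"
  assumes f: "f \<in> hv_dual"
    and H1: "finite_rank (\<lambda>(i, j). f (lmonom (i + j), 0))"
    and H2: "finite_rank (\<lambda>(i, j). f (0, lmonom (i + j)))"
  shows "f \<in> hv.finite_dual"
proof -
  define e :: "int + int \<Rightarrow> int" where "e = case_sum (\<lambda>i. i) (\<lambda>i. i)"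
  note comp = finite_rank_comp[where u = "\<lambda>a. e a - 1" and v = e]
  have "(\<lambda>(a, b). f (hv_bracket (hv_monom a) (hv_monom b))) =
      (\<lambda>(x, y). case_sum (\<lambda>i. 1) (\<lambda>i. 0) x * case_sum of_int (\<lambda>i. 0) y * (\<lambda>(i, j). f (lmonom (i + j), 0)) (e x - 1, e y)) +
      (\<lambda>(x, y). case_sum (\<lambda>i. - of_int i) (\<lambda>i. 0) x * case_sum (\<lambda>i. 1) (\<lambda>i. 0) y * (\<lambda>(i, j). f (lmonom (i + j), 0)) (e x - 1, e y)) +
      (\<lambda>(x, y). case_sum (\<lambda>i. 1) (\<lambda>i. 0) x * case_sum (\<lambda>i. 0) of_int y * (\<lambda>(i, j). f (0, lmonom (i + j))) (e x - 1, e y)) +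
      (\<lambda>(x, y). case_sum (\<lambda>i. 0) (\<lambda>i. - of_int i) x * case_sum (\<lambda>i. 1) (\<lambda>i. 0) y * (\<lambda>(i, j). f (0, lmonom (i + j))) (e x - 1, e y))"
    (is "_ = ?M")
  proof
    fix p :: "(int + int) \<times> (int + int)"
    obtain a b where p: "p = (a, b)" by (cases p)
    show "(\<lambda>(a, b). f (hv_bracket (hv_monom a) (hv_monom b))) p = ?M p"
      unfolding p
      by (cases a; cases b)
        (simp_all add: e_def hv_bracket_monom hv.dualD[OF f], simp_all add: hv_monom_def algebra_simps)
  qed
  then have "finite_rank (\<lambda>(a, b). f (hv_bracket (hv_monom a) (hv_monom b)))"
    by (simp only:) (intro finite_rank_add comp H1 H2)
  then obtain n :: nat and g h where gh:
    "\<forall>a b. f (hv_bracket (hv_monom a) (hv_monom b)) = (\<Sum>k<n. g k a * h k b)"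
    using finite_rank_sum by fastforce
  have "bracket_dual hv_bracket f (\<xi>, \<eta>) =
      (\<Sum>k<n. (\<Sum>a\<in>hv_support \<xi>. hv_eps a \<xi> * g k a) * (\<Sum>b\<in>hv_support \<eta>. hv_eps b \<eta> * h k b))" for \<xi> \<eta>
  proof -
    have dual: "(\<lambda>\<xi>. f (hv_bracket \<xi> \<eta>)) \<in> hv_dual" "(\<lambda>\<eta>. f (hv_bracket \<xi> \<eta>)) \<in> hv_dual" for \<xi> \<eta>
      by (simp_all add: hv.dual_space_iff linear_on_def hv.br_add hv.br_scale hv.dualD[OF f])
    have e1: "f (hv_bracket \<xi> \<eta>) = (\<Sum>a\<in>hv_support \<xi>. hv_eps a \<xi> * f (hv_bracket (hv_monom a) \<eta>))"
      by (rule hv_dual_expansion[OF dual(1)])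
    have e2: "f (hv_bracket (hv_monom a) \<eta>) =
        (\<Sum>b\<in>hv_support \<eta>. hv_eps b \<eta> * f (hv_bracket (hv_monom a) (hv_monom b)))" for a
      by (rule hv_dual_expansion[OF dual(2)])
    have "f (hv_bracket \<xi> \<eta>) =
        (\<Sum>a\<in>hv_support \<xi>. hv_eps a \<xi> * (\<Sum>b\<in>hv_support \<eta>. hv_eps b \<eta> * (\<Sum>k<n. g k a * h k b)))"
      unfolding e1 e2 gh[rule_format] ..
    also have "\<dots> = (\<Sum>a\<in>hv_support \<xi>. \<Sum>k<n. \<Sum>b\<in>hv_support \<eta>. (hv_eps a \<xi> * g k a) * (hv_eps b \<eta> * h k b))"
      by (subst sum.swap) (simp add: sum_distrib_left mult_ac)
    also have "\<dots> = (\<Sum>k<n. (\<Sum>a\<in>hv_support \<xi>. hv_eps a \<xi> * g k a) * (\<Sum>b\<in>hv_support \<eta>. hv_eps b \<eta> * h k b))"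
      by (subst sum.swap) (simp add: sum_product)
    finally show ?thesis by (simp add: bracket_dual_def)
  qed
  then have "finite_rank (bracket_dual hv_bracket f)" by (intro finite_rankI)
  with f show ?thesis by (simp add: hv.finite_dual_def)
qed

lemma hv_circ_eq:
  "(hv_circ :: ('k::field_char_0 hv \<Rightarrow> 'k) set) =
    {functional_pair f g | f g. f \<in> laurent_circ \<and> g \<in> laurent_circ}"
  unfolding hv.maximal_good_subspace_eq
proof (intro equalityI subsetI)
  fix f :: "'k hv \<Rightarrow> 'k" assume f: "f \<in> hv.finite_dual"
  then have d: "f \<in> hv_dual" by (simp add: hv.finite_dual_def)
  have "(\<lambda>p. f (p, 0)) \<in> laurent_circ"
    unfolding laurent_circ_def
    using hankel_finite_rank_imp_recursive[OF hankel_finite_rank_of_finite_dual(1)[OF f]] hv_dual_components(1)[OF d]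
    by simp
  moreover have "(\<lambda>q. f (0, q)) \<in> laurent_circ"
    unfolding laurent_circ_def
    using hankel_finite_rank_imp_recursive[OF hankel_finite_rank_of_finite_dual(2)[OF f]] hv_dual_components(2)[OF d]
    by simp
  ultimately show "f \<in> {functional_pair f g | f g. f \<in> laurent_circ \<and> g \<in> laurent_circ}"
    using hv_dual_components(3)[OF d] by blast
next
  fix F :: "'k hv \<Rightarrow> 'k" assume "F \<in> {functional_pair f g | f g. f \<in> laurent_circ \<and> g \<in> laurent_circ}"
  then obtain f g where F: "F = functional_pair f g" and fg: "f \<in> laurent_circ" "g \<in> laurent_circ" by blast
  from fg have d: "f \<in> dual_space laurent_scale" "g \<in> dual_space laurent_scale" by (auto simp: laurent_circ_def)
  interpret f: Vector_Spaces.linear laurent_scale "(*)" f using d by (simp add: dual_space_def)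
  interpret g: Vector_Spaces.linear laurent_scale "(*)" g using d by (simp add: dual_space_def)
  have "finite_rank (\<lambda>(i, j). f (lmonom (i + j)))" "finite_rank (\<lambda>(i, j). g (lmonom (i + j)))"
    using fg by (intro recursive_imp_hankel_finite_rank; simp add: laurent_circ_def)+
  then show "F \<in> hv.finite_dual"
    by (intro finite_dual_of_hankel_finite_rank)
      (use functional_pair_dual[OF d] in \<open>simp_all add: F functional_pair_def f.zero g.zero\<close>)
qed

section \<open>Formal infinite linear combinations\<close>

lemma is_formal_sumI:
  assumes "\<And>x. finite (J x)" "\<And>x. J x \<subseteq> I" "\<And>x i. i \<in> I \<Longrightarrow> i \<notin> J x \<Longrightarrow> F i x = 0"
    and "\<And>x. g x = (\<Sum>i\<in>J x. F i x)"
  shows "is_formal_sum F I g"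
  unfolding is_formal_sum_def
proof (intro allI conjI)
  fix x
  show "finite {i\<in>I. F i x \<noteq> 0}"
    by (rule finite_subset[OF _ assms(1)[of x]]) (use assms(3) in auto)
  show "g x = (\<Sum>i\<in>{i\<in>I. F i x \<noteq> 0}. F i x)"
    unfolding assms(4) by (rule sum.mono_neutral_right) (use assms(1,2)[of x] assms(3)[of _ x] in auto)
qed

lemma is_formal_sum_unique: "is_formal_sum F I g \<Longrightarrow> is_formal_sum F I h \<Longrightarrow> g = h"
  by (auto simp: is_formal_sum_def fun_eq_iff)

lemma hv_eps_dual: "hv_eps a \<in> hv_dual"
  by (cases a) (auto simp: hv.dual_space_iff linear_on_def lookup_add hv_scale_def lookup_laurent_scale)

lemma eps1_eq: "eps1 i = hv_eps (Inl i)" and eps2_eq: "eps2 i = hv_eps (Inr i)"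
  by (simp_all add: hv_eps_def)

lemma hv_dual_expansion_superset:
  assumes "f \<in> hv_dual" "finite S" "hv_support \<xi> \<subseteq> S"
  shows "f \<xi> = (\<Sum>a\<in>S. hv_eps a \<xi> * f (hv_monom a))"
  unfolding hv_dual_expansion[OF assms(1), of \<xi>]
  by (rule sum.mono_neutral_left) (use assms(2,3) in \<open>auto simp: hv_support_def\<close>)

section \<open>The dual of the bracket on coordinate functionals\<close>

lemma lookup_single_mult:
  "Poly_Mapping.lookup (Poly_Mapping.single i c * g) p = c * Poly_Mapping.lookup (g :: 'k::field laurent) (p - i)"
proof (induction g rule: laurent_induct)
  case (single n d)
  show ?case by (auto simp: mult_single lookup_single when_def)
qed (simp_all add: lookup_add algebra_simps)

lemma lookup_mult_sum:
  fixes f g :: "'k::field laurent"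
  assumes "finite K" "Poly_Mapping.keys f \<subseteq> K"
  shows "Poly_Mapping.lookup (f * g) p = (\<Sum>i\<in>K. Poly_Mapping.lookup f i * Poly_Mapping.lookup g (p - i))"
proof -
  have "f * g = (\<Sum>i\<in>Poly_Mapping.keys f. Poly_Mapping.single i (Poly_Mapping.lookup f i) * g)"
    using laurent_expansion[of f] by (simp add: laurent_scale_single flip: sum_distrib_right)
  then have "Poly_Mapping.lookup (f * g) p =
      (\<Sum>i\<in>Poly_Mapping.keys f. Poly_Mapping.lookup f i * Poly_Mapping.lookup g (p - i))"
    by (simp add: lookup_sum lookup_single_mult)
  also have "\<dots> = (\<Sum>i\<in>K. Poly_Mapping.lookup f i * Poly_Mapping.lookup g (p - i))"
    by (rule sum.mono_neutral_left) (use assms in \<open>auto simp: in_keys_iff\<close>)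
  finally show ?thesis .
qed

lemma lookup_mult_deriv:
  fixes f g :: "'k::field laurent"
  assumes "finite K" "Poly_Mapping.keys f \<subseteq> K"
  shows "Poly_Mapping.lookup (f * laurent_deriv g) p =
      (\<Sum>i\<in>K. of_int (p + 1 - i) * (Poly_Mapping.lookup f i * Poly_Mapping.lookup g (p + 1 - i)))"
    and "Poly_Mapping.lookup (laurent_deriv f * g) p =
      (\<Sum>i\<in>K. of_int i * (Poly_Mapping.lookup f i * Poly_Mapping.lookup g (p + 1 - i)))"
proof -
  show 1: "Poly_Mapping.lookup (f * laurent_deriv g) p =
      (\<Sum>i\<in>K. of_int (p + 1 - i) * (Poly_Mapping.lookup f i * Poly_Mapping.lookup g (p + 1 - i)))"
    unfolding lookup_mult_sum[OF assms] by (intro sum.cong) (simp_all add: laurent_deriv.rep_eq algebra_simps)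
  have "Poly_Mapping.lookup (laurent_deriv f * g) p =
      Poly_Mapping.lookup (laurent_deriv (f * g)) p - Poly_Mapping.lookup (f * laurent_deriv g) p"
    by (simp add: laurent_deriv_mult lookup_add)
  also have "\<dots> = (\<Sum>i\<in>K. of_int i * (Poly_Mapping.lookup f i * Poly_Mapping.lookup g (p + 1 - i)))"
    unfolding 1 by (simp add: laurent_deriv.rep_eq lookup_mult_sum[OF assms] sum_distrib_left
        algebra_simps flip: sum_subtractf sum.distrib)
  finally show "Poly_Mapping.lookup (laurent_deriv f * g) p =
      (\<Sum>i\<in>K. of_int i * (Poly_Mapping.lookup f i * Poly_Mapping.lookup g (p + 1 - i)))" .
qed

text \<open>
  For given \<open>\<xi>\<close>, only the pairs \<open>(i, p + 1 - i)\<close> with \<open>i\<close> in the support of a component of \<open>\<xi>\<close> contribute.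
\<close>

lemma bracket_dual_eps:
  "is_formal_sum (\<lambda>(i, j). fscale (of_int (j - i)) (form_tensor (eps1 i) (eps1 j)))
     {(i, j). i + j = p + 1} (bracket_dual hv_bracket (eps1 p :: 'k::field hv \<Rightarrow> 'k))"
  "is_formal_sum (\<lambda>(i, j). fscale (of_int j) (form_tensor (eps1 i) (eps2 j))
       - fscale (of_int i) (form_tensor (eps2 i) (eps1 j)))
     {(i, j). i + j = p + 1} (bracket_dual hv_bracket (eps2 p :: 'k::field hv \<Rightarrow> 'k))"
proof -
  define K where "K x = Poly_Mapping.keys (fst (fst x)) \<union> Poly_Mapping.keys (snd (fst x))"
    for x :: "'k hv \<times> 'k hv"
  define J where "J x = (\<lambda>i. (i, p + 1 - i)) ` K x" for x
  have K: "finite (K x)" "Poly_Mapping.keys (fst (fst x)) \<subseteq> K x" "Poly_Mapping.keys (snd (fst x)) \<subseteq> K x" for x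
    by (auto simp: K_def)
  have J: "finite (J x)" "J x \<subseteq> {(i, j). i + j = p + 1}" for x
    using K by (auto simp: J_def)
  have notJ: "Poly_Mapping.lookup (fst (fst x)) i = 0" "Poly_Mapping.lookup (snd (fst x)) i = 0"
    if "i + j = p + 1" "(i, j) \<notin> J x" for i j x
  proof -
    from that have "i \<notin> K x" by (auto simp: J_def)
    then show "Poly_Mapping.lookup (fst (fst x)) i = 0" "Poly_Mapping.lookup (snd (fst x)) i = 0"
      by (auto simp: K_def in_keys_iff)
  qed
  have sumJ: "(\<Sum>q\<in>J x. H q) = (\<Sum>i\<in>K x. H (i, p + 1 - i))" for x and H :: "_ \<Rightarrow> 'k"
    unfolding J_def by (subst sum.reindex) (auto simp: inj_on_def)
  show "is_formal_sum (\<lambda>(i, j). fscale (of_int (j - i)) (form_tensor (eps1 i) (eps1 j)))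
      {(i, j). i + j = p + 1} (bracket_dual hv_bracket (eps1 p :: 'k hv \<Rightarrow> 'k))"
  proof (rule is_formal_sumI[OF J])
    show "(case q of (i, j) \<Rightarrow> fscale (of_int (j - i)) (form_tensor (eps1 i) (eps1 j))) x = 0"
      if "q \<in> {(i, j). i + j = p + 1}" "q \<notin> J x" for q and x :: "'k hv \<times> 'k hv"
      using notJ[of "fst q" "snd q" x] that
      by (cases x) (auto simp: eps1_eq fscale_def form_tensor_def)
    show "bracket_dual hv_bracket (eps1 p) x =
        (\<Sum>q\<in>J x. (case q of (i, j) \<Rightarrow> fscale (of_int (j - i)) (form_tensor (eps1 i) (eps1 j))) x)"
      for x :: "'k hv \<times> 'k hv"
    proof (cases x rule: prod.exhaust)
      case (Pair \<xi> \<eta>)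
      have "bracket_dual hv_bracket (eps1 p) x =
          Poly_Mapping.lookup (fst \<xi> * laurent_deriv (fst \<eta>)) p - Poly_Mapping.lookup (laurent_deriv (fst \<xi>) * fst \<eta>) p"
        by (simp add: Pair bracket_dual_def eps1_eq hv_bracket_eq lookup_minus mult.commute)
      also have "\<dots> = (\<Sum>i\<in>K x. of_int (p + 1 - i - i) *
          (Poly_Mapping.lookup (fst \<xi>) i * Poly_Mapping.lookup (fst \<eta>) (p + 1 - i)))"
        unfolding lookup_mult_deriv[OF K(1) K(2)[of x, unfolded Pair fst_conv], folded Pair]
        by (simp add: algebra_simps flip: sum_subtractf)
      finally show ?thesis
        by (simp add: sumJ Pair eps1_eq fscale_def form_tensor_def)
    qed
  qed
  show "is_formal_sum (\<lambda>(i, j). fscale (of_int j) (form_tensor (eps1 i) (eps2 j))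
       - fscale (of_int i) (form_tensor (eps2 i) (eps1 j)))
     {(i, j). i + j = p + 1} (bracket_dual hv_bracket (eps2 p :: 'k hv \<Rightarrow> 'k))"
  proof (rule is_formal_sumI[OF J])
    show "(case q of (i, j) \<Rightarrow> fscale (of_int j) (form_tensor (eps1 i) (eps2 j))
       - fscale (of_int i) (form_tensor (eps2 i) (eps1 j))) x = 0"
      if "q \<in> {(i, j). i + j = p + 1}" "q \<notin> J x" for q and x :: "'k hv \<times> 'k hv"
      using notJ[of "fst q" "snd q" x] that
      by (cases x) (auto simp: eps1_eq eps2_eq fscale_def form_tensor_def)
    show "bracket_dual hv_bracket (eps2 p) x =
        (\<Sum>q\<in>J x. (case q of (i, j) \<Rightarrow> fscale (of_int j) (form_tensor (eps1 i) (eps2 j))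
          - fscale (of_int i) (form_tensor (eps2 i) (eps1 j))) x)"
      for x :: "'k hv \<times> 'k hv"
    proof (cases x rule: prod.exhaust)
      case (Pair \<xi> \<eta>)
      have "bracket_dual hv_bracket (eps2 p) x =
          Poly_Mapping.lookup (fst \<xi> * laurent_deriv (snd \<eta>)) p - Poly_Mapping.lookup (laurent_deriv (snd \<xi>) * fst \<eta>) p"
        by (simp add: Pair bracket_dual_def eps2_eq hv_bracket_eq lookup_minus mult.commute)
      also have "\<dots> = (\<Sum>i\<in>K x. of_int (p + 1 - i) *
            (Poly_Mapping.lookup (fst \<xi>) i * Poly_Mapping.lookup (snd \<eta>) (p + 1 - i))
          - of_int i * (Poly_Mapping.lookup (snd \<xi>) i * Poly_Mapping.lookup (fst \<eta>) (p + 1 - i)))"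
        unfolding lookup_mult_deriv(1)[OF K(1) K(2)[of x, unfolded Pair fst_conv], folded Pair]
          lookup_mult_deriv(2)[OF K(1) K(3)[of x, unfolded Pair fst_conv], folded Pair]
        by (simp add: sum_subtractf)
      finally show ?thesis
        by (simp add: sumJ Pair eps1_eq eps2_eq fscale_def form_tensor_def)
    qed
  qed
qed

lemma bracket_dual_formally_linear:
  "formally_linear (bracket_dual hv_bracket :: ('k::field hv \<Rightarrow> 'k) \<Rightarrow> _)"
  unfolding formally_linear_def
proof
  fix f :: "'k hv \<Rightarrow> 'k" assume f: "f \<in> hv_dual"
  show "is_formal_sum (\<lambda>a. fscale (f (hv_monom a)) (bracket_dual hv_bracket (hv_eps a))) UNIV (bracket_dual hv_bracket f)"
  proof (rule is_formal_sumI[where J = "\<lambda>x. hv_support (hv_bracket (fst x) (snd x))"])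
    fix x :: "'k hv \<times> 'k hv"
    show "bracket_dual hv_bracket f x = (\<Sum>a\<in>hv_support (hv_bracket (fst x) (snd x)).
        fscale (f (hv_monom a)) (bracket_dual hv_bracket (hv_eps a)) x)"
      using hv_dual_expansion[OF f, of "hv_bracket (fst x) (snd x)"]
      by (simp add: bracket_dual_def fscale_def case_prod_unfold mult.commute)
  qed (rule finite_hv_support, simp_all add: hv_support_def bracket_dual_def fscale_def case_prod_unfold)
qed

lemma formally_linear_eqI:
  assumes "formally_linear \<Psi>" "formally_linear \<Psi>'" "\<And>a. \<Psi> (hv_eps a) = \<Psi>' (hv_eps a)" "f \<in> hv_dual"
  shows "\<Psi> f = \<Psi>' f"
  using assms unfolding formally_linear_def by (metis (no_types, lifting) is_formal_sum_unique ext)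

lemma formally_linear_cong:
  assumes "formally_linear \<Psi>'" "\<And>f. f \<in> hv_dual \<Longrightarrow> \<Psi> f = \<Psi>' f"
  shows "formally_linear \<Psi>"
  using assms by (simp add: formally_linear_def hv_eps_dual)

lemma formally_bilinear_eqI:
  assumes b: "formally_bilinear b" and b': "formally_bilinear b'"
    and eq: "\<And>a a'. b (hv_eps a) (hv_eps a') = b' (hv_eps a) (hv_eps a')"
    and f: "f \<in> hv_dual" "h \<in> hv_dual"
  shows "b f h = b' f h"
proof -
  have "is_formal_sum (\<lambda>(a, a'). fscale (f (hv_monom a) * h (hv_monom a')) (b' (hv_eps a) (hv_eps a'))) UNIV (b f h)"
    using b f unfolding formally_bilinear_def eq by blast
  moreover have "is_formal_sum (\<lambda>(a, a'). fscale (f (hv_monom a) * h (hv_monom a')) (b' (hv_eps a) (hv_eps a'))) UNIV (b' f h)"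
    using b' f unfolding formally_bilinear_def by blast
  ultimately show ?thesis by (rule is_formal_sum_unique)
qed

lemma formally_bilinear_cong:
  assumes "formally_bilinear b'" "\<And>f h. f \<in> hv_dual \<Longrightarrow> h \<in> hv_dual \<Longrightarrow> b f h = b' f h"
  shows "formally_bilinear b"
  using assms by (simp add: formally_bilinear_def hv_eps_dual)

section \<open>The dual of the cobracket on coordinate functionals\<close>

text \<open>The relations that the bracket of the dual satisfies on the coordinate functionals.\<close>

definition dual_bracket_relations ::
  "'k \<Rightarrow> 'k \<Rightarrow> 'k \<Rightarrow> (('k::field hv \<Rightarrow> 'k) \<Rightarrow> ('k hv \<Rightarrow> 'k) \<Rightarrow> 'k hv \<Rightarrow> 'k) \<Rightarrow> bool" where
  "dual_bracket_relations \<alpha> \<beta> \<gamma> b \<longleftrightarrow>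
     (\<forall>f\<in>hv_dual. \<forall>h\<in>hv_dual. b f h = - b h f) \<and>
     (\<forall>i j. b (eps1 i) (eps1 j) = 0) \<and>
     (\<forall>i j. b (eps1 i) (eps2 j) = 0) \<and>
     (\<forall>i j. j \<noteq> 0 \<longrightarrow> b (eps2 i) (eps2 j) =
        (if i = 0 then fscale (of_int j * \<alpha> + \<gamma>) (eps1 (j + 1)) + fscale \<beta> (eps2 j) else 0))"

text \<open>The value at \<open>i = j = 0\<close> in the second family is not listed; skew-symmetry makes it zero.\<close>

lemma dual_bracket_relations_unique:
  fixes b b' :: "('k::field_char_0 hv \<Rightarrow> 'k) \<Rightarrow> ('k hv \<Rightarrow> 'k) \<Rightarrow> 'k hv \<Rightarrow> 'k"
  assumes b: "dual_bracket_relations \<alpha> \<beta> \<gamma> b" and b': "dual_bracket_relations \<alpha> \<beta> \<gamma> b'"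
  shows "b (hv_eps a) (hv_eps a') = b' (hv_eps a) (hv_eps a')"
proof -
  have skew: "b (hv_eps c) (hv_eps c') = - b (hv_eps c') (hv_eps c)"
    "b' (hv_eps c) (hv_eps c') = - b' (hv_eps c') (hv_eps c)" for c c'
    using b b' hv_eps_dual unfolding dual_bracket_relations_def by blast+
  have self: "b (hv_eps c) (hv_eps c) = 0" "b' (hv_eps c) (hv_eps c) = 0" for c
    using skew[of c c] by (auto simp: fun_eq_iff)
  have eq: "b (hv_eps (Inl i)) (hv_eps c) = b' (hv_eps (Inl i)) (hv_eps c)" for i c
    using b b' by (cases c) (simp_all add: dual_bracket_relations_def eps1_eq eps2_eq)
  have eq2: "b (hv_eps (Inr i)) (hv_eps (Inr j)) = b' (hv_eps (Inr i)) (hv_eps (Inr j))" if "j \<noteq> 0" for i j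
    using b b' that by (simp add: dual_bracket_relations_def eps1_eq eps2_eq)
  show ?thesis
  proof (cases a)
    case (Inl i)
    then show ?thesis using eq by simp
  next
    case (Inr i)
    show ?thesis
    proof (cases a')
      case (Inl j)
      then show ?thesis using eq skew[of a a'] by simp
    next
      case a': (Inr j)
      consider "j \<noteq> 0" | "i \<noteq> 0" | "i = 0" "j = 0" by blast
      then show ?thesis
        using eq2 self skew[of a a'] by cases (simp_all add: Inr a')
    qed
  qed
qed

lemma dual_bracket_relations_cong:
  assumes rel: "dual_bracket_relations \<alpha> \<beta> \<gamma> b'"
    and eq: "\<And>f h. f \<in> hv_dual \<Longrightarrow> h \<in> hv_dual \<Longrightarrow> b f h = b' f h"
  shows "dual_bracket_relations \<alpha> \<beta> \<gamma> b"
proof -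
  have skew: "b f h = - b h f" if "f \<in> hv_dual" "h \<in> hv_dual" for f h
    unfolding eq[OF that] eq[OF that(2,1)] using rel that unfolding dual_bracket_relations_def by blast
  have eps: "b (hv_eps a) (hv_eps a') = b' (hv_eps a) (hv_eps a')" for a a'
    by (rule eq[OF hv_eps_dual hv_eps_dual])
  show ?thesis
    using rel skew unfolding dual_bracket_relations_def eps1_eq eps2_eq eps by blast
qed

text \<open>
  The cobracket of the theorem, given through the derivation of its second factor. Its dual bracket is
  \<open>[f, h](\<xi>) = f(I\<^sub>0) h(D \<xi>) - f(D \<xi>) h(I\<^sub>0)\<close>.
\<close>

locale hv_cobracket =
  fixes \<alpha> \<beta> \<gamma> :: "'k::field_char_0" and \<delta> :: "'k hv \<Rightarrow> ('k, 'k hv) tensor2"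
  assumes \<delta>: "\<delta> \<xi> = hv_tensor (hv_I 0) (hv_derivation \<alpha> \<beta> \<gamma> \<xi>) - hv_tensor (hv_derivation \<alpha> \<beta> \<gamma> \<xi>) (hv_I 0)"
begin

lemma dual_bracket_eq:
  assumes "f \<in> hv_dual" "h \<in> hv_dual"
  shows "dual_bracket \<delta> f h \<xi> =
    f (hv_I 0) * h (hv_derivation \<alpha> \<beta> \<gamma> \<xi>) - f (hv_derivation \<alpha> \<beta> \<gamma> \<xi>) * h (hv_I 0)"
  using hv.form_tensor_bilinear[OF assms] by (simp add: dual_bracket_def \<delta> tensor_def form_tensor_def)

lemma hv_eps_I_0: "hv_eps a (hv_I 0) = (if a = Inr 0 then 1 else 0)"
  by (cases a) (auto simp: hv_I_def lookup_single when_def lookup_one)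

lemma hv_eps_derivation:
  "hv_eps (Inl i) (hv_derivation \<alpha> \<beta> \<gamma> \<xi>) = 0"
  "hv_eps (Inr i) (hv_derivation \<alpha> \<beta> \<gamma> \<xi>) =
    (of_int i * \<alpha> + \<gamma>) * hv_eps (Inl (i + 1)) \<xi> + \<beta> * hv_eps (Inr i) \<xi>"
  by (simp_all add: hv_derivation_def lookup_add lookup_laurent_scale laurent_deriv.rep_eq
      lookup_single_mult) (simp add: algebra_simps)

lemma dual_bracket_relations: "dual_bracket_relations \<alpha> \<beta> \<gamma> (dual_bracket \<delta>)"
  unfolding dual_bracket_relations_def eps1_eq eps2_eq
  by (auto simp: fun_eq_iff dual_bracket_eq hv_eps_dual hv_eps_I_0 hv_eps_derivation fscale_def
      simp del: hv_eps_simps)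

lemma dual_bracket_formally_bilinear: "formally_bilinear (dual_bracket \<delta>)"
  unfolding formally_bilinear_def
proof (intro ballI)
  fix f h :: "'k hv \<Rightarrow> 'k" assume f: "f \<in> hv_dual" and h: "h \<in> hv_dual"
  define S where "S \<xi> = insert (Inr 0) (hv_support (hv_derivation \<alpha> \<beta> \<gamma> \<xi>))" for \<xi>
  have S: "finite (S \<xi>)" "hv_support (hv_I 0 :: 'k hv) \<subseteq> S \<xi>" "hv_support (hv_derivation \<alpha> \<beta> \<gamma> \<xi>) \<subseteq> S \<xi>" for \<xi>
    by (auto simp: S_def hv_support_def[of "hv_I 0"] hv_eps_I_0 split: if_splits)
  show "is_formal_sum (\<lambda>(a, a'). fscale (f (hv_monom a) * h (hv_monom a')) (dual_bracket \<delta> (hv_eps a) (hv_eps a')))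
      UNIV (dual_bracket \<delta> f h)"
  proof (rule is_formal_sumI[where J = "\<lambda>\<xi>. S \<xi> \<times> S \<xi>"])
    fix \<xi> and p :: "(int + int) \<times> (int + int)"
    assume "p \<notin> S \<xi> \<times> S \<xi>"
    then show "(case p of (a, a') \<Rightarrow>
        fscale (f (hv_monom a) * h (hv_monom a')) (dual_bracket \<delta> (hv_eps a) (hv_eps a'))) \<xi> = 0"
      by (cases p) (auto simp: S_def fscale_def dual_bracket_eq hv_eps_dual hv_eps_I_0 hv_support_def
          simp del: hv_eps_simps)
  next
    fix \<xi>
    let ?D = "hv_derivation \<alpha> \<beta> \<gamma> \<xi>"
    note exp = hv_dual_expansion_superset[OF _ S(1)]
    have "dual_bracket \<delta> f h \<xi> =
        (\<Sum>a\<in>S \<xi>. hv_eps a (hv_I 0) * f (hv_monom a)) * (\<Sum>a\<in>S \<xi>. hv_eps a ?D * h (hv_monom a)) -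
        (\<Sum>a\<in>S \<xi>. hv_eps a ?D * f (hv_monom a)) * (\<Sum>a\<in>S \<xi>. hv_eps a (hv_I 0) * h (hv_monom a))"
      unfolding dual_bracket_eq[OF f h] exp[OF f S(2), of \<xi>] exp[OF f S(3)] exp[OF h S(2), of \<xi>] exp[OF h S(3)] ..
    also have "\<dots> = (\<Sum>a\<in>S \<xi>. \<Sum>a'\<in>S \<xi>. f (hv_monom a) * h (hv_monom a') *
        (hv_eps a (hv_I 0) * hv_eps a' ?D - hv_eps a ?D * hv_eps a' (hv_I 0)))"
      unfolding sum_product sum_subtractf[symmetric]
      by (intro sum.cong refl) (simp add: algebra_simps del: hv_eps_simps)
    finally show "dual_bracket \<delta> f h \<xi> = (\<Sum>p\<in>S \<xi> \<times> S \<xi>. (case p of (a, a') \<Rightarrow>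
        fscale (f (hv_monom a) * h (hv_monom a')) (dual_bracket \<delta> (hv_eps a) (hv_eps a'))) \<xi>)"
      by (simp add: sum.cartesian_product fscale_def dual_bracket_eq hv_eps_dual case_prod_unfold)
  qed (use S in auto)
qed

end

theorem theorem3p9:
  fixes \<alpha> \<beta> \<gamma> :: "'k::{alg_closed_field, field_char_0}"
    and \<delta> :: "'k hv \<Rightarrow> ('k, 'k hv) tensor2"
  assumes \<delta>_linear: "Vector_Spaces.linear hv_scale fscale \<delta>"
    and \<delta>_L: "\<And>n. \<delta> (hv_L n) =
          fscale (of_int n * \<alpha> + \<gamma>) (hv_tensor (hv_I 0) (hv_I n) - hv_tensor (hv_I n) (hv_I 0))"
    and \<delta>_I: "\<And>n. \<delta> (hv_I n) =
          fscale \<beta> (hv_tensor (hv_I 0) (hv_I n) - hv_tensor (hv_I n) (hv_I 0))"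
  shows "lie_bialgebra_on hv_scale UNIV hv_bracket \<delta> \<and>
    is_dual_lie_bialgebra hv_scale hv_bracket \<delta>
      hv_circ (dual_bracket \<delta>) (dual_cobracket hv_scale hv_bracket) \<and>
    (hv_circ :: ('k hv \<Rightarrow> 'k) set) =
      {functional_pair f g | f g. f \<in> laurent_circ \<and> g \<in> laurent_circ} \<and>
    (\<forall>\<Psi> :: ('k hv \<Rightarrow> 'k) \<Rightarrow> 'k hv \<times> 'k hv \<Rightarrow> 'k.
      (formally_linear \<Psi> \<and>
       (\<forall>p. is_formal_sum (\<lambda>(i, j). fscale (of_int (j - i)) (form_tensor (eps1 i) (eps1 j)))
              {(i, j). i + j = p + 1} (\<Psi> (eps1 p))) \<and>
       (\<forall>p. is_formal_sum (\<lambda>(i, j). fscale (of_int j) (form_tensor (eps1 i) (eps2 j))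
                                  - fscale (of_int i) (form_tensor (eps2 i) (eps1 j)))
              {(i, j). i + j = p + 1} (\<Psi> (eps2 p))))
      \<longleftrightarrow> (\<forall>f\<in>hv_dual. \<Psi> f = bracket_dual hv_bracket f)) \<and>
    (\<forall>f\<in>(hv_circ :: ('k hv \<Rightarrow> 'k) set). \<forall>t\<in>tensor_space fscale hv_circ.
      tensor_form t = bracket_dual hv_bracket f \<longleftrightarrow> t = dual_cobracket hv_scale hv_bracket f) \<and>
    (\<forall>b :: ('k hv \<Rightarrow> 'k) \<Rightarrow> ('k hv \<Rightarrow> 'k) \<Rightarrow> 'k hv \<Rightarrow> 'k.
      (formally_bilinear b \<and>
       (\<forall>f\<in>hv_dual. \<forall>h\<in>hv_dual. b f h = - b h f) \<and>
       (\<forall>i j. b (eps1 i) (eps1 j) = 0) \<and>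
       (\<forall>i j. b (eps1 i) (eps2 j) = 0) \<and>
       (\<forall>i j. j \<noteq> 0 \<longrightarrow> b (eps2 i) (eps2 j) =
          (if i = 0 then fscale (of_int j * \<alpha> + \<gamma>) (eps1 (j + 1)) + fscale \<beta> (eps2 j) else 0)))
      \<longleftrightarrow> (\<forall>f\<in>hv_dual. \<forall>h\<in>hv_dual. b f h = dual_bracket \<delta> f h))"
proof -
  note \<delta> = hv_cobracket_eq[OF \<delta>_linear \<delta>_L \<delta>_I]
  have bialg: "lie_bialgebra_on hv_scale UNIV hv_bracket \<delta>"
    by (rule hv_lie_bialgebra_on[OF \<delta>_linear \<delta>])
  interpret B: lie_bialgebra hv_scale hv_bracket \<delta>
    by unfold_locales (rule bialg)
  interpret C: hv_cobracket \<alpha> \<beta> \<gamma> \<delta>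
    by unfold_locales (rule \<delta>)
  have cobracket: "(formally_linear \<Psi> \<and>
       (\<forall>p. is_formal_sum (\<lambda>(i, j). fscale (of_int (j - i)) (form_tensor (eps1 i) (eps1 j)))
              {(i, j). i + j = p + 1} (\<Psi> (eps1 p))) \<and>
       (\<forall>p. is_formal_sum (\<lambda>(i, j). fscale (of_int j) (form_tensor (eps1 i) (eps2 j))
                                  - fscale (of_int i) (form_tensor (eps2 i) (eps1 j)))
              {(i, j). i + j = p + 1} (\<Psi> (eps2 p))))
      \<longleftrightarrow> (\<forall>f\<in>hv_dual. \<Psi> f = bracket_dual hv_bracket f)" (is "?A \<longleftrightarrow> ?B")
    for \<Psi> :: "('k hv \<Rightarrow> 'k) \<Rightarrow> 'k hv \<times> 'k hv \<Rightarrow> 'k"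
  proof
    assume A: ?A
    have "\<Psi> (eps1 p) = bracket_dual hv_bracket (eps1 p)" "\<Psi> (eps2 p) = bracket_dual hv_bracket (eps2 p)" for p
      using A by (blast intro: is_formal_sum_unique bracket_dual_eps)+
    then have "\<Psi> (hv_eps a) = bracket_dual hv_bracket (hv_eps a)" for a
      by (cases a) (simp_all add: eps1_eq eps2_eq)
    with A show ?B by (blast intro: formally_linear_eqI bracket_dual_formally_linear)
  next
    assume B: ?B
    then have eps: "\<Psi> (eps1 p) = bracket_dual hv_bracket (eps1 p)" "\<Psi> (eps2 p) = bracket_dual hv_bracket (eps2 p)" for p
      using hv_eps_dual unfolding eps1_eq eps2_eq by blast+
    from B have "formally_linear \<Psi>" by (blast intro: formally_linear_cong bracket_dual_formally_linear)
    then show ?A unfolding eps using bracket_dual_eps by blast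
  qed
  have bracket: "(formally_bilinear b \<and> dual_bracket_relations \<alpha> \<beta> \<gamma> b)
      \<longleftrightarrow> (\<forall>f\<in>hv_dual. \<forall>h\<in>hv_dual. b f h = dual_bracket \<delta> f h)" (is "?A \<longleftrightarrow> ?B")
    for b :: "('k hv \<Rightarrow> 'k) \<Rightarrow> ('k hv \<Rightarrow> 'k) \<Rightarrow> 'k hv \<Rightarrow> 'k"
  proof
    assume ?A
    then show ?B
      using formally_bilinear_eqI[OF _ C.dual_bracket_formally_bilinear]
        dual_bracket_relations_unique[OF _ C.dual_bracket_relations] by blast
  next
    assume B: ?B
    have "dual_bracket_relations \<alpha> \<beta> \<gamma> b"
      by (rule dual_bracket_relations_cong[OF C.dual_bracket_relations]) (use B in blast)
    moreover have "formally_bilinear b"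
      by (rule formally_bilinear_cong[OF C.dual_bracket_formally_bilinear]) (use B in blast)
    ultimately show ?A by blast
  qed
  show ?thesis
    using bialg B.is_dual_lie_bialgebra_finite_dual hv_circ_eq cobracket
      hv.dual_cobracket_unique[folded hv.maximal_good_subspace_eq] bracket[unfolded dual_bracket_relations_def]
    by (intro conjI) blast+
qed

end
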